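(* $p(K_9)=15$.
   Context: $K_n$ is the complete graph on $n$ vertices. An edge-coloring of a graph $G$ is any assignment of colors to its edges. A parity walk (in an edge-coloring) is a walk along which every color is used an even number of times. A parity path is a parity walk that is a path with at least one edge. A parity edge-coloring is an edge-coloring having no parity path, and $p(G)$ is the minimum number of colors in a parity edge-coloring of $G$. *)

theory Defs
  imports "Graph_Theory.Graph_Theory"
begin

(* Graph_Theory models a simple undirected graph as a finite symmetric digraph (locale graph);
   an undirected edge is the unordered pair of ends shared by an arc and its reverse.
   Edge-colorings are functions on such unordered pairs, so that an arc and its reverse get the
   same color by construction; values outside edges G are irrelevant. *)

definition edge_of :: "('a, 'b) pre_digraph \<Rightarrow> 'b \<Rightarrow> 'a set" where
  "edge_of G e = {tail G e, head G e}"

definition edges :: "('a, 'b) pre_digraph \<Rightarrow> 'a set set" where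
  "edges G = edge_of G ` arcs G"

definition parity_walk ::
  "('a, 'b) pre_digraph \<Rightarrow> ('a set \<Rightarrow> 'c) \<Rightarrow> 'a \<Rightarrow> 'b awalk \<Rightarrow> 'a \<Rightarrow> bool" where
  "parity_walk G f u p v \<longleftrightarrow>
     pre_digraph.awalk G u p v \<and>
     (\<forall>x. even (count_list (map (\<lambda>e. f (edge_of G e)) p) x))"

definition parity_path ::
  "('a, 'b) pre_digraph \<Rightarrow> ('a set \<Rightarrow> 'c) \<Rightarrow> 'a \<Rightarrow> 'b awalk \<Rightarrow> 'a \<Rightarrow> bool" where
  "parity_path G f u p v \<longleftrightarrow>
     parity_walk G f u p v \<and> pre_digraph.apath G u p v \<and> p \<noteq> []"

definition parity_edge_coloring :: "('a, 'b) pre_digraph \<Rightarrow> ('a set \<Rightarrow> 'c) \<Rightarrow> bool" where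
  "parity_edge_coloring G f \<longleftrightarrow> (\<nexists>u p v. parity_path G f u p v)"

(* The number of colors of a coloring is the number of colors occurring on edges. For a finite
   graph, natural numbers provide enough colors, and card and LEAST are not degenerate:
   see parity_edge_coloring_exists. *)
definition parity_number :: "('a, 'b) pre_digraph \<Rightarrow> nat" where
  "parity_number G =
     (LEAST k. \<exists>f :: 'a set \<Rightarrow> nat. parity_edge_coloring G f \<and> card (f ` edges G) = k)"

lemma parity_edge_coloring_exists:
  assumes "graph G"
  shows "\<exists>f :: 'a set \<Rightarrow> nat. parity_edge_coloring (G :: ('a, 'b) pre_digraph) f
           \<and> finite (f ` edges G)"
proof -
  interpret graph G by fact
  have fin: "finite (edges G)"
    by (simp add: edges_def)
  obtain f :: "'a set \<Rightarrow> nat" where f: "inj_on f (edges G)"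
    using fin finite_imp_inj_to_nat_seg by blast
  have False if path: "parity_path G f u p v" for u p v
  proof -
    obtain e q where p: "p = e # q"
      using path by (auto simp: parity_path_def neq_Nil_conv)
    have aw: "awalk u (e # q) v" and dist: "distinct (awalk_verts u (e # q))"
      and ev: "even (count_list (map (\<lambda>e. f (edge_of G e)) (e # q)) (f (edge_of G e)))"
      using path unfolding parity_path_def parity_walk_def apath_def p by blast+
    have "f (edge_of G e) \<in> set (map (\<lambda>e. f (edge_of G e)) q)"
    proof (rule ccontr)
      assume "f (edge_of G e) \<notin> set (map (\<lambda>e. f (edge_of G e)) q)"
      then have "count_list (map (\<lambda>e. f (edge_of G e)) q) (f (edge_of G e)) = 0"
        by (simp only: count_list_0_iff) simp
      with ev show False
        by simp
    qed
    then obtain e' where e': "e' \<in> set q" "f (edge_of G e) = f (edge_of G e')"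
      by auto
    with f aw have "edge_of G e = edge_of G e'"
      by (auto simp: inj_on_def edges_def awalk_def)
    moreover have aq: "awalk (head G e) q v"
      using aw by (simp add: awalk_Cons_iff)
    have "tail G e' \<in> set (awalk_verts (head G e) q) \<and> head G e' \<in> set (awalk_verts (head G e) q)"
      using aq e'(1) by (simp add: set_awalk_verts)
    ultimately show False
      using dist by (auto simp: edge_of_def doubleton_eq_iff)
  qed
  then show ?thesis
    using fin by (auto simp: parity_edge_coloring_def)
qed

lemma complete_digraph_exists: "\<exists>G :: (nat, nat \<times> nat) pre_digraph. K\<^bsub>n\<^esub> G"
  by (rule exI[of _ "with_proj \<lparr> pverts = {..<n}, parcs = {(u, v). u < n \<and> v < n \<and> u \<noteq> v} \<rparr>"])
    (auto simp: complete_digraph_pair_def)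

end

theory Submission
  imports Defs "HOL-Library.Multiset"
begin

text \<open>
  Labelling the vertices by \<open>0, \<dots>, 8\<close> and coloring each edge by the bitwise sum of its ends uses only the
  colors \<open>1, \<dots>, 15\<close>; the colors of a walk add up to the sum of its ends, so a parity walk is closed.

  Conversely, with 14 colors some color occurs on three of the 36 edges, which are pairwise disjoint and span six
  vertices. Up to symmetry, the \<open>K\<^sub>6\<close> on these vertices has only eleven colorings without a parity path.
  For each of them a search tree of 46 to 629 nodes shows that the coloring does not extend to
  \<open>K\<^sub>9\<close>: every node branches over the color of one further edge, and a color is excluded by a parity path
  with 2, 4 or 6 edges. The trees list only the edges to branch on; the parity paths are found by a checker
  that is evaluated by the simplifier.
\<close>

section \<open>The certificate checker\<close>

text \<open>Why eleven: let \<open>x\<close> be the color of three disjoint edges, and let another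
  color \<open>y\<close> lie on two edges of the K6. They are disjoint, and each joins two of the
  three \<open>x\<close>-edges. If they do not join the same two, they have the form
  \<open>ab\<close> and \<open>a'c\<close> with \<open>aa'\<close> an \<open>x\<close>-edge, and for
  the \<open>x\<close>-edge \<open>cc'\<close> the path \<open>b a a' c c'\<close> has the word
  \<open>yxyx\<close>. So \<open>y\<close> can repeat only on opposite sides inside one of the three
  K4's spanned by two \<open>x\<close>-edges. Each K4 has two such opposite pairs, and a coloring is
  determined by which of the six pairs agree: 64 cases. The symmetries of the matching permute the
  six pairs as \<open>S4\<close> permutes the edges of a K4, so the classes correspond to the eleven
  graphs on four vertices. The obstacle is that a fresh color can never be excluded, so a search
  branch closes only after all 14 colors have appeared. A K6 coloring with few colors therefore
  leaves most freedom. The extreme case has seven colors and is the restriction of the bitwise sum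
  on 3-bit labels, which is free of parity paths on eight vertices; only the ninth vertex forces a
  fourth bit.\<close>

datatype vertex = V0 | V1 | V2 | V3 | V4 | V5 | V6 | V7 | V8
text \<open>Eighteen names, so that a table indexed by colors is a pair of rows; only the 14 in \<open>palette\<close> are used.\<close>
datatype color = Low vertex | High vertex
datatype 'a row = Row 'a 'a 'a 'a 'a 'a 'a 'a 'a

primrec get :: "'a row \<Rightarrow> vertex \<Rightarrow> 'a" where
  "get (Row a b c d e f g h i) v = (case v of V0 \<Rightarrow> a | V1 \<Rightarrow> b | V2 \<Rightarrow> c | V3 \<Rightarrow> d | V4 \<Rightarrow> e
     | V5 \<Rightarrow> f | V6 \<Rightarrow> g | V7 \<Rightarrow> h | V8 \<Rightarrow> i)"
lemma get_code [code]:
  "get (Row a b c d e f g h i) V0 = a"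
  "get (Row a b c d e f g h i) V1 = b"
  "get (Row a b c d e f g h i) V2 = c"
  "get (Row a b c d e f g h i) V3 = d"
  "get (Row a b c d e f g h i) V4 = e"
  "get (Row a b c d e f g h i) V5 = f"
  "get (Row a b c d e f g h i) V6 = g"
  "get (Row a b c d e f g h i) V7 = h"
  "get (Row a b c d e f g h i) V8 = i"
  by simp_all

fun upd :: "'a row \<Rightarrow> vertex \<Rightarrow> 'a \<Rightarrow> 'a row" where
  "upd (Row a b c d e f g h i) V0 x = Row x b c d e f g h i"
| "upd (Row a b c d e f g h i) V1 x = Row a x c d e f g h i"
| "upd (Row a b c d e f g h i) V2 x = Row a b x d e f g h i"
| "upd (Row a b c d e f g h i) V3 x = Row a b c x e f g h i"
| "upd (Row a b c d e f g h i) V4 x = Row a b c d x f g h i"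
| "upd (Row a b c d e f g h i) V5 x = Row a b c d e x g h i"
| "upd (Row a b c d e f g h i) V6 x = Row a b c d e f x h i"
| "upd (Row a b c d e f g h i) V7 x = Row a b c d e f g x i"
| "upd (Row a b c d e f g h i) V8 x = Row a b c d e f g h x"

definition const_row :: "'a \<Rightarrow> 'a row" where
  "const_row x = Row x x x x x x x x x"

definition vertices :: "vertex list" where
  "vertices = [V0, V1, V2, V3, V4, V5, V6, V7, V8]"

definition palette :: "color list" where
  "palette = [Low V0, Low V1, Low V2, Low V3, Low V4, Low V5, Low V6, Low V7, Low V8,
    High V0, High V1, High V2, High V3, High V4]"

text \<open>
  A state consists of a partial coloring, as a matrix, and a table giving the neighbor of a vertex along a color.
  The table only guides the search for parity paths and is never assumed to agree with the matrix.
\<close>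

type_synonym mat = "color option row row"
type_synonym mates = "vertex option row row \<times> vertex option row row"

definition color_at :: "mat \<Rightarrow> vertex \<Rightarrow> vertex \<Rightarrow> color option" where
  "color_at m u v = get (get m u) v"

definition update :: "'a row row \<Rightarrow> vertex \<Rightarrow> vertex \<Rightarrow> 'a \<Rightarrow> 'a row row" where
  "update m u v x = upd m u (upd (get m u) v x)"

definition paint :: "mat \<Rightarrow> vertex \<Rightarrow> vertex \<Rightarrow> color \<Rightarrow> mat" where
  "paint m u v A = update (update m u v (Some A)) v u (Some A)"

fun mate :: "mates \<Rightarrow> color \<Rightarrow> vertex \<Rightarrow> vertex option" where
  "mate (s, t) (Low A) v = get (get s A) v"
| "mate (s, t) (High A) v = get (get t A) v"

fun join :: "mates \<Rightarrow> vertex \<Rightarrow> vertex \<Rightarrow> color \<Rightarrow> mates" where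
  "join (s, t) u v (Low A) = (update (update s A u (Some v)) A v (Some u), t)"
| "join (s, t) u v (High A) = (s, update (update t A u (Some v)) A v (Some u))"

text \<open>
  The simplifier normalizes anew whatever a conditional or a logical connective uncovers, which is costly for terms
  containing a state. The functions below therefore dispatch by pattern matching on evaluated arguments.
\<close>

fun either :: "bool \<Rightarrow> bool \<Rightarrow> bool" where
  "either True x = True" | "either False x = x"
fun both :: "bool \<Rightarrow> bool \<Rightarrow> bool" where
  "both True x = x" | "both False x = False"

section \<open>Parity words and parity paths in a partial coloring\<close>

function even_word :: "'a list \<Rightarrow> bool" where
  "even_word [] = True"
| "even_word (x # xs) = (x \<in> set xs \<and> even_word (remove1 x xs))"
  by pat_completeness auto
termination
  by (relation "measure length") (auto simp: length_remove1)

fun path_word :: "('a \<Rightarrow> 'a \<Rightarrow> 'c) \<Rightarrow> 'a list \<Rightarrow> 'c list" where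
  "path_word f (u # v # vs) = f u v # path_word f (v # vs)"
| "path_word f vs = []"

fun color_word :: "mat \<Rightarrow> vertex list \<Rightarrow> color option list" where
  "color_word m (u # v # vs) = color_at m u v # color_word m (v # vs)"
| "color_word m vs = []"

text \<open>The empty word is rejected because a parity path has an edge, and \<open>None\<close>
  because two uncolored edges would otherwise count as equally colored.\<close>

definition even_opt :: "color option list \<Rightarrow> bool" where
  "even_opt w = (w \<noteq> [] \<and> None \<notin> set w \<and> even_word w)"
definition even_colored :: "bool \<Rightarrow> mat \<Rightarrow> vertex list \<Rightarrow> bool" where
  "even_colored d m vs = (d \<and> even_opt (color_word m vs))"
lemma even_colored_code [code]:
  "even_colored False m vs = False"
  "even_colored True m vs = even_opt (color_word m vs)"
  by (simp_all add: even_colored_def)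

text \<open>The second conjunct generalizes distinctness to a table of visited vertices. Evaluation
  then marks one vertex per step instead of comparing all pairs.\<close>

definition avoids :: "bool row \<Rightarrow> vertex list \<Rightarrow> bool" where
  "avoids r vs = (distinct vs \<and> (\<forall>v\<in>set vs. \<not> get r v))"
definition avoids_if :: "bool \<Rightarrow> bool row \<Rightarrow> vertex \<Rightarrow> vertex list \<Rightarrow> bool" where
  "avoids_if b r v vs = (\<not> b \<and> avoids (upd r v True) vs)"
lemma get_upd: "get (upd r v x) w = (if v = w then x else get r w)"
  by (cases r; cases v; cases w) simp_all
lemma avoids_code [code]:
  "avoids r [] = True"
  "avoids r (v # vs) = avoids_if (get r v) r v vs"
  "avoids_if True r v vs = False"
  "avoids_if False r v vs = avoids (upd r v True) vs"
  by (auto simp: avoids_def avoids_if_def get_upd)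

definition even_path :: "mat \<Rightarrow> vertex list \<Rightarrow> bool" where
  "even_path m vs = even_colored (avoids (const_row False) vs) m vs"

fun extend :: "vertex option \<Rightarrow> mat \<Rightarrow> vertex list \<Rightarrow> bool" where
  "extend None m vs = False"
| "extend (Some p) m vs = even_path m (p # vs)"

fun extend2 :: "vertex option \<Rightarrow> mat \<Rightarrow> mates \<Rightarrow> color \<Rightarrow> vertex list \<Rightarrow> bool" where
  "extend2 None m t Z vs = False"
| "extend2 (Some p) m t Z vs = extend (mate t Z p) m (p # vs)"

fun extend_ends :: "vertex option \<Rightarrow> vertex option \<Rightarrow> mat \<Rightarrow> vertex list \<Rightarrow> bool" where
  "extend_ends (Some p) (Some q) m vs = even_path m (p # vs @ [q])"
| "extend_ends None q m vs = False"
| "extend_ends (Some p) None m vs = False"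

text \<open>
  Let \<open>A\<close> be the color just given to an edge, and let \<open>ab\<close>, \<open>cd\<close> be this edge and another one of color \<open>A\<close>.
  In a properly colored graph a shortest parity path with at most six edges has one of the color words
  \<open>xyxy\<close>, \<open>xyzxyz\<close>, \<open>xyxzyz\<close>, \<open>xyzxzy\<close>, up to reversal. The path is determined by the part from \<open>a\<close> to \<open>d\<close> and
  at most one more edge; \<open>gap1\<close>, \<open>gap2\<close>, \<open>gap3\<close> treat the cases of one, two and three edges between \<open>b\<close> and \<open>c\<close>.
\<close>

fun four :: "color option \<Rightarrow> mat \<Rightarrow> mates \<Rightarrow> vertex \<Rightarrow> vertex \<Rightarrow> vertex \<Rightarrow> vertex \<Rightarrow> bool" where
  "four None m t a b c d = False"
| "four (Some X) m t a b c d = either (extend (mate t X a) m [a, b, c, d]) (extend (mate t X d) m [d, c, b, a])"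

fun gap1_at :: "color option \<Rightarrow> vertex \<Rightarrow> mat \<Rightarrow> mates \<Rightarrow> vertex \<Rightarrow> vertex \<Rightarrow> vertex \<Rightarrow> vertex \<Rightarrow> color \<Rightarrow> bool" where
  "gap1_at None e m t a b c d X = False"
| "gap1_at (Some Z) e m t a b c d X =
     either (extend2 (mate t X e) m t Z [e, d, c, b, a]) (extend2 (mate t Z a) m t X [a, b, c, d, e])"

fun gap1_loop :: "vertex list \<Rightarrow> mat \<Rightarrow> mates \<Rightarrow> vertex \<Rightarrow> vertex \<Rightarrow> vertex \<Rightarrow> vertex \<Rightarrow> color \<Rightarrow> bool" where
  "gap1_loop [] m t a b c d X = False"
| "gap1_loop (e # es) m t a b c d X = either (gap1_at (color_at m d e) e m t a b c d X) (gap1_loop es m t a b c d X)"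

fun gap1 :: "color option \<Rightarrow> vertex list \<Rightarrow> mat \<Rightarrow> mates \<Rightarrow> vertex \<Rightarrow> vertex \<Rightarrow> vertex \<Rightarrow> vertex \<Rightarrow> bool" where
  "gap1 None rs m t a b c d = False"
| "gap1 (Some X) rs m t a b c d = gap1_loop rs m t a b c d X"

fun gap3_at :: "color option \<Rightarrow> mat \<Rightarrow> mates \<Rightarrow> vertex \<Rightarrow> vertex list \<Rightarrow> bool" where
  "gap3_at None m t d vs = False"
| "gap3_at (Some Y) m t d vs = extend (mate t Y d) m vs"

fun gap3 :: "vertex option \<Rightarrow> mat \<Rightarrow> mates \<Rightarrow> vertex \<Rightarrow> vertex \<Rightarrow> vertex \<Rightarrow> vertex \<Rightarrow> vertex \<Rightarrow> bool" where
  "gap3 None m t a b n c d = False"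
| "gap3 (Some k) m t a b n c d = gap3_at (color_at m n k) m t d [d, c, k, n, b, a]"

fun gap2_at :: "color option \<Rightarrow> color \<Rightarrow> vertex \<Rightarrow> mat \<Rightarrow> mates \<Rightarrow> vertex \<Rightarrow> vertex \<Rightarrow> vertex \<Rightarrow> vertex \<Rightarrow> bool" where
  "gap2_at None X n m t a b c d = False"
| "gap2_at (Some Y) X n m t a b c d =
    either (extend2 (mate t X d) m t Y [d, c, n, b, a])
   (either (extend2 (mate t Y d) m t X [d, c, n, b, a])
   (either (extend_ends (mate t Y a) (mate t X d) m [a, b, n, c, d])
           (extend_ends (mate t X a) (mate t Y d) m [a, b, n, c, d])))"

fun gap2_from :: "color option \<Rightarrow> vertex \<Rightarrow> mat \<Rightarrow> mates \<Rightarrow> vertex \<Rightarrow> vertex \<Rightarrow> vertex \<Rightarrow> vertex \<Rightarrow> bool" where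
  "gap2_from None n m t a b c d = False"
| "gap2_from (Some X) n m t a b c d = either (gap2_at (color_at m n c) X n m t a b c d) (gap3 (mate t X c) m t a b n c d)"

fun gap2_loop :: "vertex list \<Rightarrow> mat \<Rightarrow> mates \<Rightarrow> vertex \<Rightarrow> vertex \<Rightarrow> vertex \<Rightarrow> vertex \<Rightarrow> bool" where
  "gap2_loop [] m t a b c d = False"
| "gap2_loop (n # ns) m t a b c d = either (gap2_from (color_at m b n) n m t a b c d) (gap2_loop ns m t a b c d)"

definition six :: "vertex list \<Rightarrow> mat \<Rightarrow> mates \<Rightarrow> vertex \<Rightarrow> vertex \<Rightarrow> vertex \<Rightarrow> vertex \<Rightarrow> bool" where
  "six rs m t a b c d = either (gap1 (color_at m b c) rs m t a b c d) (gap2_loop rs m t a b c d)"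

text \<open>The gap searches treat the two ends of a path differently, so both edges take the
  leading place, and \<open>uv\<close> is taken in both directions. The other direction of
  \<open>cd\<close> arises when the scan over all vertices reaches \<open>d\<close> in place of
  \<open>c\<close>.\<close>

definition six_all :: "vertex list \<Rightarrow> mat \<Rightarrow> mates \<Rightarrow> vertex \<Rightarrow> vertex \<Rightarrow> vertex \<Rightarrow> vertex \<Rightarrow> bool" where
  "six_all rs m t u v c d =
    either (either (six rs m t u v c d) (six rs m t v u c d)) (either (six rs m t d c v u) (six rs m t d c u v))"

definition others :: "vertex \<Rightarrow> vertex \<Rightarrow> vertex \<Rightarrow> vertex \<Rightarrow> vertex list" where
  "others a b c d = removeAll a (removeAll b (removeAll c (removeAll d vertices)))"

section \<open>Search for a parity path through a newly colored edge\<close>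

definition scan4a :: "vertex option \<Rightarrow> mat \<Rightarrow> mates \<Rightarrow> vertex \<Rightarrow> vertex \<Rightarrow> vertex \<Rightarrow> bool" where
  "scan4a x m t u v c = (case x of None \<Rightarrow> False
    | Some d \<Rightarrow> either (four (color_at m v c) m t u v c d) (four (color_at m u c) m t v u c d))"
lemma scan4a_code [code]:
  "scan4a None m t u v c = False"
  "scan4a (Some d) m t u v c = either (four (color_at m v c) m t u v c d) (four (color_at m u c) m t v u c d)"
  by (simp_all add: scan4a_def)

primrec scan4 :: "vertex list \<Rightarrow> mat \<Rightarrow> mates \<Rightarrow> color \<Rightarrow> vertex \<Rightarrow> vertex \<Rightarrow> bool" where
  "scan4 [] m t A u v = False"
| "scan4 (c # cs) m t A u v = either (scan4a (mate t A c) m t u v c) (scan4 cs m t A u v)"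

definition scan6a :: "bool \<Rightarrow> vertex option \<Rightarrow> mat \<Rightarrow> mates \<Rightarrow> vertex \<Rightarrow> vertex \<Rightarrow> vertex \<Rightarrow> bool" where
  "scan6a r x m t u v c = (r \<or> (case x of None \<Rightarrow> False
    | Some d \<Rightarrow> six_all (others u v c d) m t u v c d))"
lemma scan6a_code [code]:
  "scan6a True x m t u v c = True"
  "scan6a False None m t u v c = False"
  "scan6a False (Some d) m t u v c = six_all (others u v c d) m t u v c d"
  by (simp_all add: scan6a_def)

text \<open>Two tables are carried: \<open>t\<close> predates the coloring of \<open>uv\<close>, so
  that \<open>cd\<close> ranges over the other edges of color \<open>A\<close>, while
  \<open>t'\<close> includes \<open>uv\<close> and serves to complete the path. The verdict is
  accumulated in \<open>r\<close>.\<close>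

primrec scan6 :: "vertex list \<Rightarrow> bool \<Rightarrow> mat \<Rightarrow> mates \<Rightarrow> mates \<Rightarrow> color \<Rightarrow> vertex \<Rightarrow> vertex \<Rightarrow> bool" where
  "scan6 [] r m t t' A u v = r"
| "scan6 (c # cs) r m t t' A u v = scan6 cs (scan6a r (mate t A c) m t' u v c) m t t' A u v"

fun violated_four :: "bool \<Rightarrow> mat \<Rightarrow> mates \<Rightarrow> mates \<Rightarrow> color \<Rightarrow> vertex \<Rightarrow> vertex \<Rightarrow> bool" where
  "violated_four True m t t' A u v = True"
| "violated_four False m t t' A u v = scan6 vertices False m t t' A u v"

fun violated_proper :: "vertex option \<Rightarrow> vertex option \<Rightarrow> mat \<Rightarrow> mates \<Rightarrow> color \<Rightarrow> vertex \<Rightarrow> vertex \<Rightarrow> bool" where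
  "violated_proper (Some w) x m t A u v = even_path m [w, u, v]"
| "violated_proper None (Some w) m t A u v = even_path m [u, v, w]"
| "violated_proper None None m t A u v = violated_four (scan4 vertices m t A u v) m t (join t u v A) A u v"

definition violated :: "mat \<Rightarrow> mates \<Rightarrow> vertex \<Rightarrow> vertex \<Rightarrow> color \<Rightarrow> bool" where
  "violated m t u v A = violated_proper (mate t A u) (mate t A v) m t A u v"

section \<open>Search trees\<close>

type_synonym pattern = "(vertex \<times> vertex \<times> color) list"

text \<open>
  The subtrees of \<open>Branch u v\<close> belong to the colors of \<open>uv\<close> that are not excluded: first the next unused
  color, if any, then the used ones in the order of the list of used colors. One unused color suffices since they
  are interchangeable. \<open>Copy n p\<close> claims that \<open>p\<close> embeds the \<open>n\<close>-th refuted pattern into the current coloring.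
\<close>

datatype cert = Branch vertex vertex "cert list" | Copy nat "vertex row"

definition same_pattern :: "(color option \<times> color) list \<Rightarrow> bool" where
  "same_pattern xs = list_all (\<lambda>(x, A). x \<noteq> None \<and> list_all (\<lambda>(y, B). (x = y) = (A = B)) xs) xs"

text \<open>The embedding is injective on all nine vertices, not only on those in the pattern, so it
  carries a whole coloring of the K9 and not just the part already painted.\<close>

definition is_copy :: "pattern \<Rightarrow> vertex row \<Rightarrow> mat \<Rightarrow> bool" where
  "is_copy pat p m = (distinct (map (get p) vertices) \<and>
     same_pattern (map (\<lambda>(u, v, A). (color_at m (get p u) (get p v), A)) pat))"

text \<open>A fresh color is accepted untested, since a color on a single edge completes no parity
  path. Hence a \<open>Branch\<close> without subtrees can succeed only when \<open>fs\<close> is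
  empty. The painted matrix and the verdict of \<open>violated\<close> are arguments of
  \<open>check_color\<close> so that they are evaluated before the case distinction.\<close>

function (sequential) check :: "pattern list \<Rightarrow> color list \<Rightarrow> color list \<Rightarrow> mat \<Rightarrow> mates \<Rightarrow> cert \<Rightarrow> bool"
and check_colors :: "pattern list \<Rightarrow> color list \<Rightarrow> color list \<Rightarrow> mat \<Rightarrow> mates \<Rightarrow> vertex \<Rightarrow> vertex \<Rightarrow> color list \<Rightarrow> cert list \<Rightarrow> bool"
and check_color :: "mat \<Rightarrow> bool \<Rightarrow> pattern list \<Rightarrow> color list \<Rightarrow> color list \<Rightarrow> mat \<Rightarrow> mates \<Rightarrow> vertex \<Rightarrow> vertex \<Rightarrow> color \<Rightarrow> color list \<Rightarrow> cert list \<Rightarrow> bool" where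
  "check db us [] m t (Branch u v cs) = check_colors db us [] m t u v us cs"
| "check db us (A # fs) m t (Branch u v (c # cs)) =
    both (check db (A # us) fs (paint m u v A) (join t u v A) c) (check_colors db us (A # fs) m t u v us cs)"
| "check db us (A # fs) m t (Branch u v []) = False"
| "check db us fs m t (Copy n p) = (n < length db \<and> is_copy (db ! n) p m)"
| "check_colors db us fs m t u v [] cs = True"
| "check_colors db us fs m t u v (A # As) cs =
    check_color (paint m u v A) (violated (paint m u v A) t u v A) db us fs m t u v A As cs"
| "check_color m' True db us fs m t u v A As cs = check_colors db us fs m t u v As cs"
| "check_color m' False db us fs m t u v A As [] = False"
| "check_color m' False db us fs m t u v A As (c # cs) =
    both (check db us fs m' (join t u v A) c) (check_colors db us fs m t u v As cs)"
  by pat_completeness auto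
termination
  by (relation "measures [\<lambda>x. case x of Inl (_, _, _, _, _, c) \<Rightarrow> size c
        | Inr (Inl (_, _, _, _, _, _, _, _, cs)) \<Rightarrow> size_list size cs
        | Inr (Inr (_, _, _, _, _, _, _, _, _, _, _, cs)) \<Rightarrow> size_list size cs,
      \<lambda>x. case x of Inl (_, _, _, _, _, c) \<Rightarrow> 0
        | Inr (Inl (_, _, _, _, _, _, _, As, cs)) \<Rightarrow> 2 * length As
        | Inr (Inr (_, _, _, _, _, _, _, _, _, _, As, cs)) \<Rightarrow> 2 * length As + 1]") auto

definition no_color :: mat where "no_color = const_row (const_row None)"
definition no_mate :: mates where "no_mate = (const_row (const_row None), const_row (const_row None))"

fun check_from :: "pattern \<Rightarrow> color list \<Rightarrow> color list \<Rightarrow> mat \<Rightarrow> mates \<Rightarrow> pattern list \<Rightarrow> cert \<Rightarrow> bool" where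
  "check_from [] us fs m t db c = check db us fs m t c"
| "check_from ((u, v, A) # pat) us fs m t db c = check_from pat us fs (paint m u v A) (join t u v A) db c"

text \<open>The names used by the pattern start in palette order and later ones are put in front;
  the subtrees of a certificate rely on this order.\<close>

definition refutes :: "pattern list \<Rightarrow> pattern \<Rightarrow> cert \<Rightarrow> bool" where
  "refutes db pat c = (list_all (\<lambda>(u, v, A). A \<in> set palette) pat \<and>
     check_from pat (filter (\<lambda>A. A \<in> set (map (snd \<circ> snd) pat)) palette)
     (filter (\<lambda>A. A \<notin> set (map (snd \<circ> snd) pat)) palette) no_color no_mate db c)"

section \<open>Colorings of six vertices\<close>

definition K6 :: "(vertex \<times> vertex) list" where
  "K6 = [(V0, V1), (V0, V2), (V1, V2), (V0, V3), (V1, V3), (V2, V3), (V0, V4), (V1, V4), (V2, V4), (V3, V4),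
    (V0, V5), (V1, V5), (V2, V5), (V3, V5), (V4, V5)]"

text \<open>The first 1, 3, 6, 10, 15 entries of \<open>K6\<close> form cliques on 2, 3, 4, 5, 6
  vertices, so a coloring of a smaller clique is an initial segment of the list of colors.\<close>

definition clique_pattern :: "color list \<Rightarrow> pattern" where
  "clique_pattern As = map (\<lambda>((u, v), A). (u, v, A)) (zip K6 As)"

section \<open>Soundness of the checker\<close>

lemma set_vertices: "set vertices = UNIV"
  unfolding vertices_def by (auto intro: vertex.exhaust)
lemma finite_vertex: "finite (UNIV :: vertex set)"
  by (metis List.finite_set set_vertices)

text \<open>Cancelling the first letter against a later copy preserves the parity of every count; if
  there is no later copy, the first letter occurs exactly once.\<close>

lemma even_word_iff: "even_word xs \<longleftrightarrow> (\<forall>y. even (count (mset xs) y))"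
proof (induction xs rule: even_word.induct)
  case (2 x xs)
  show ?case
  proof (cases "x \<in> set xs")
    case True
    then obtain N where "mset xs = add_mset x N"
      by (metis insert_DiffM set_mset_mset)
    then show ?thesis using 2 True by auto
  next
    case False
    have c: "count (mset xs) x = 0" using False by simp
    have "odd (count (mset (x # xs)) x)" by (subst mset.simps, subst count_add_mset, subst c) simp
    then show ?thesis using False by auto
  qed
qed simp

text \<open>Letters cancel in equal pairs, and a renaming, even one that merges letters, maps equal
  pairs to equal pairs.\<close>

lemma even_word_map: "even_word xs \<Longrightarrow> even_word (map f xs)"
proof (induction xs rule: even_word.induct)
  case (2 x xs)
  then obtain N where "mset xs = add_mset x N"
    by (metis even_word.simps(2) insert_DiffM set_mset_mset)
  moreover have "\<forall>y. even (count (mset (remove1 x xs)) y)" "\<forall>y. even (count (mset (map f (remove1 x xs))) y)"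
    using 2 by (simp_all only: even_word.simps even_word_iff[symmetric])
  ultimately show ?case by (simp add: even_word_iff)
qed simp

section \<open>Partial colorings as information on a full coloring\<close>

lemma color_at_paint:
  "color_at (paint m u v A) x y = (if x = u \<and> y = v \<or> x = v \<and> y = u then Some A else color_at m x y)"
  by (auto simp: color_at_def paint_def update_def get_upd)

text \<open>A parity edge-coloring of K9 with at most 14 colors, stated on vertex lists. The range
  includes the values on the diagonal, so these have to be chosen among the colors of edges.\<close>

definition small_parity_coloring :: "(vertex \<Rightarrow> vertex \<Rightarrow> 'c) \<Rightarrow> bool" where
  "small_parity_coloring F \<longleftrightarrow> (\<forall>u v. F u v = F v u) \<and> card (range (case_prod F)) \<le> 14 \<and>
     (\<forall>vs. distinct vs \<longrightarrow> 2 \<le> length vs \<longrightarrow> \<not> even_word (path_word F vs))"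

definition matches :: "(vertex \<Rightarrow> vertex \<Rightarrow> 'c) \<Rightarrow> pattern \<Rightarrow> bool" where
  "matches F pat \<longleftrightarrow> (\<forall>(u, v, A) \<in> set pat. \<forall>(u', v', B) \<in> set pat. (F u v = F u' v') = (A = B))"

text \<open>\<open>g\<close> assigns actual colors to the names in use, and every entry of the
  matrix is true of \<open>F\<close>. That used names denote colors of \<open>F\<close> is what
  makes the counting in \<open>realizes_all\<close> possible.\<close>

definition realizes :: "(color \<Rightarrow> 'c) \<Rightarrow> (vertex \<Rightarrow> vertex \<Rightarrow> 'c) \<Rightarrow> color list \<Rightarrow> mat \<Rightarrow> bool" where
  "realizes g F us m \<longleftrightarrow> inj_on g (set us) \<and> g ` set us \<subseteq> range (case_prod F) \<and>
     (\<forall>u v A. color_at m u v = Some A \<longrightarrow> A \<in> set us \<and> F u v = g A)"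

lemma realizes_paint:
  assumes "small_parity_coloring F" "realizes g F us m" "A \<in> set us" "F u v = g A"
  shows "realizes g F us (paint m u v A)"
  using assms unfolding small_parity_coloring_def realizes_def by (auto simp: color_at_paint split: if_splits)

lemma color_word_path_word:
  assumes "realizes g F us m" "None \<notin> set (color_word m vs)"
  shows "path_word F vs = map (g \<circ> the) (color_word m vs)"
  using assms by (induction m vs rule: color_word.induct) (auto simp: realizes_def)

lemma color_word_length: "color_word m vs \<noteq> [] \<Longrightarrow> 2 \<le> length vs"
  by (induction m vs rule: color_word.induct) auto

text \<open>Along colored edges the word read from the matrix is the word of \<open>F\<close>
  written in names. Translating it by \<open>g\<close> keeps it even, so an even path in the matrix
  would be a parity path of \<open>F\<close>.\<close>

lemma realizes_no_even_path:
  assumes "small_parity_coloring F" "realizes g F us m"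
  shows "\<not> even_path m vs"
proof
  assume "even_path m vs"
  then have "distinct vs" and w: "color_word m vs \<noteq> []" "None \<notin> set (color_word m vs)" "even_word (color_word m vs)"
    by (auto simp: even_path_def even_colored_def even_opt_def avoids_def)
  moreover have "even_word (path_word F vs)"
    using color_word_path_word[OF assms(2) w(2)] even_word_map[OF w(3)] by simp
  ultimately show False
    using assms(1) color_word_length unfolding small_parity_coloring_def by blast
qed

section \<open>The path search raises no false alarm\<close>

lemma either_iff: "either x y \<longleftrightarrow> x \<or> y" by (cases x) simp_all
lemma both_iff: "both x y \<longleftrightarrow> x \<and> y" by (cases x) simp_all

context
  fixes m :: mat
  assumes no_even_path: "\<And>vs. \<not> even_path m vs"
begin

lemma extend_False: "\<not> extend x m vs"
  by (cases x) (simp_all add: no_even_path)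
lemma extend2_False: "\<not> extend2 x m t Z vs"
  by (cases x) (simp_all add: extend_False)
lemma extend_ends_False: "\<not> extend_ends x y m vs"
  by (cases x; cases y) (simp_all add: no_even_path)
lemma four_False: "\<not> four x m t a b c d"
  by (cases x) (simp_all add: extend_False either_iff)
lemma gap1_at_False: "\<not> gap1_at x e m t a b c d X"
  by (cases x) (simp_all add: extend2_False either_iff)
lemma gap1_loop_False: "\<not> gap1_loop es m t a b c d X"
  by (induction es) (simp_all add: gap1_at_False either_iff)
lemma gap1_False: "\<not> gap1 x rs m t a b c d"
  by (cases x) (simp_all add: gap1_loop_False)
lemma gap3_at_False: "\<not> gap3_at x m t d vs"
  by (cases x) (simp_all add: extend_False)
lemma gap3_False: "\<not> gap3 x m t a b n c d"
  by (cases x) (simp_all add: gap3_at_False)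
lemma gap2_at_False: "\<not> gap2_at x X n m t a b c d"
  by (cases x) (simp_all add: extend2_False extend_ends_False either_iff)
lemma gap2_from_False: "\<not> gap2_from x n m t a b c d"
  by (cases x) (simp_all add: gap2_at_False gap3_False either_iff)
lemma gap2_loop_False: "\<not> gap2_loop ns m t a b c d"
  by (induction ns) (simp_all add: gap2_from_False either_iff)
lemma six_False: "\<not> six rs m t a b c d"
  by (simp add: six_def gap1_False gap2_loop_False either_iff)
lemma scan4_False: "\<not> scan4 cs m t A u v"
  by (induction cs) (simp_all add: scan4a_def four_False either_iff split: option.splits)
lemma scan6_False: "scan6 cs r m t t' A u v = r"
  by (induction cs arbitrary: r) (simp_all add: scan6a_def six_all_def six_False either_iff split: option.splits)
text \<open>Each way to a positive answer ends in a call of \<open>even_path\<close> on the matrix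
  itself. Soundness thus follows from the shape of the search alone, whatever the table contains and
  whichever color words are covered.\<close>

lemma violated_False: "\<not> violated m t u v A"
  unfolding violated_def
  by (cases "mate t A u"; cases "mate t A v") (simp_all add: no_even_path scan4_False scan6_False)

end

section \<open>Symmetries and copies of refuted patterns\<close>

lemma path_word_map: "path_word F (map p vs) = path_word (\<lambda>u v. F (p u) (p v)) vs"
  by (induction vs rule: induct_list012) auto

lemma small_parity_coloring_reindex:
  assumes "small_parity_coloring F" "inj p"
  shows "small_parity_coloring (\<lambda>u v. F (p u) (p v))"
proof -
  have "card (range (\<lambda>(u, v). F (p u) (p v))) \<le> card (range (case_prod F))"
    by (intro card_mono) (auto simp: finite_vertex finite_Prod_UNIV)
  moreover have "distinct (map p vs) = distinct vs" for vs
    using assms(2) by (auto simp: distinct_map intro: inj_on_subset)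
  ultimately show ?thesis
    using assms(1) unfolding small_parity_coloring_def by (metis (mono_tags, lifting) length_map le_trans path_word_map)
qed

text \<open>Since \<open>g\<close> is injective on the names in use, two painted edges have the same
  name exactly when they have the same color under \<open>F\<close>; so agreement of names with the
  pattern passes to \<open>F\<close>.\<close>

lemma is_copy_sound:
  assumes "realizes g F us m" "is_copy pat p m"
  shows "inj (get p)" "matches (\<lambda>u v. F (get p u) (get p v)) pat"
proof -
  show "inj (get p)"
    using assms(2) by (simp add: is_copy_def distinct_map set_vertices)
  have *: "(color_at m (get p u) (get p v) = color_at m (get p u') (get p v')) = (A = B)"
     "color_at m (get p u) (get p v) \<noteq> None"
    if "(u, v, A) \<in> set pat" "(u', v', B) \<in> set pat" for u v A u' v' B
    using assms(2) that by (fastforce simp: is_copy_def same_pattern_def list_all_iff)+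
  have "(F (get p u) (get p v) = F (get p u') (get p v')) = (A = B)"
    if ab: "(u, v, A) \<in> set pat" "(u', v', B) \<in> set pat" for u v A u' v' B
  proof -
    obtain X Y where XY: "color_at m (get p u) (get p v) = Some X" "color_at m (get p u') (get p v') = Some Y"
      using *(2)[OF ab] *(2)[OF ab(2,1)] by auto
    then have "X \<in> set us" "Y \<in> set us" "F (get p u) (get p v) = g X" "F (get p u') (get p v') = g Y"
      and "inj_on g (set us)"
      using assms(1) unfolding realizes_def by blast+
    then have "(F (get p u) (get p v) = F (get p u') (get p v')) = (X = Y)"
      by (auto simp: inj_on_def)
    then show ?thesis using *(1)[OF ab] XY by simp
  qed
  then show "matches (\<lambda>u v. F (get p u) (get p v)) pat"
    unfolding matches_def by blast
qed

section \<open>Soundness of search trees\<close>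

lemma palette: "distinct palette" "length palette = 14"
  by (simp_all add: palette_def)

definition palette_split :: "color list \<Rightarrow> color list \<Rightarrow> bool" where
  "palette_split us fs \<longleftrightarrow> distinct us \<and> set us \<inter> set fs = {} \<and> distinct fs \<and> set us \<union> set fs = set palette"

lemma palette_split_shift: "palette_split us (A # fs) \<Longrightarrow> palette_split (A # us) fs"
  unfolding palette_split_def by auto

text \<open>Once all 14 names are in use, \<open>g\<close> is an injection of 14 names into a range
  of at most 14 colors, hence onto: no further color is possible.\<close>

lemma realizes_all:
  assumes "small_parity_coloring F" "realizes g F us m" "palette_split us []"
  shows "F u v \<in> g ` set us"
proof -
  have "card (set us) = 14"
    using assms(3) palette by (metis distinct_card set_append append_Nil2 palette_split_def list.set(1) sup_bot_right)
  then have "card (g ` set us) = 14"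
    using assms(2) by (simp add: realizes_def card_image)
  moreover have "finite (range (case_prod F))"
    by (simp add: finite_vertex finite_Prod_UNIV)
  ultimately have "g ` set us = range (case_prod F)"
    using assms(1,2) unfolding small_parity_coloring_def realizes_def by (metis card_seteq)
  then show ?thesis
    by (metis case_prod_conv rangeI)
qed

text \<open>The equations for \<open>m'\<close> and \<open>b\<close> recover the meaning of
  arguments that are passed already evaluated. \<open>g\<close> must vary in the induction because
  coloring an edge with a fresh name changes it.\<close>

lemma check_sound:
  fixes F :: "vertex \<Rightarrow> vertex \<Rightarrow> 'c"
  assumes F: "small_parity_coloring F"
    and db: "\<And>pat G. pat \<in> set db \<Longrightarrow> small_parity_coloring (G :: vertex \<Rightarrow> vertex \<Rightarrow> 'c) \<Longrightarrow> \<not> matches G pat"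
  shows "check db us fs m t c \<Longrightarrow> palette_split us fs \<Longrightarrow> \<not> realizes g F us m"
    and "check_colors db us fs m t u v As cs \<Longrightarrow> palette_split us fs \<Longrightarrow> set As \<subseteq> set us \<Longrightarrow> realizes g F us m \<Longrightarrow> F u v \<notin> g ` set As"
    and "check_color m' b db us fs m t u v A As cs \<Longrightarrow> m' = paint m u v A \<Longrightarrow> b = violated m' t u v A \<Longrightarrow>
       palette_split us fs \<Longrightarrow> set (A # As) \<subseteq> set us \<Longrightarrow> realizes g F us m \<Longrightarrow> F u v \<notin> g ` set (A # As)"
  \<comment> \<open>The list of refuted patterns is an argument of the recursion, so its assumption
    has to take part in the induction.\<close>
  using db
proof (induction db us fs m t c and db us fs m t u v As cs and m' b db us fs m t u v A As cs
    arbitrary: g and g and g rule: check_check_colors_check_color.induct)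
  case (1 db us m t u v cs)
  then show ?case using realizes_all[OF F] by auto
next
  case (2 db us A fs m t u v c cs)
  show ?case
  proof
    assume r: "realizes g F us m"
    \<comment> \<open>The remaining subtrees exclude every color already in use.\<close>
    have new: "F u v \<notin> g ` set us"
      using 2 r by (auto simp: both_iff)
    have A: "A \<notin> set us" using 2(4) by (auto simp: palette_split_def)
    \<comment> \<open>The fresh name is interpreted as the actual color of \<open>uv\<close>.
      Injectivity survives because that color is new, which is why one fresh name stands for all of
      them.\<close>
    have "realizes (g(A := F u v)) F (A # us) (paint m u v A)"
      using r A new F unfolding realizes_def small_parity_coloring_def
      by (auto simp: color_at_paint inj_on_def image_iff split: if_splits)
    then show False
      using 2 palette_split_shift by (auto simp: both_iff)
  qed
next
  case (4 db us fs m t n p)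
  then have c: "n < length db" "is_copy (db ! n) p m" by auto
  show ?case
    \<comment> \<open>Relabelling \<open>F\<close> by the embedding gives another small parity
      coloring, and this one matches a refuted pattern.\<close>
    using is_copy_sound[OF _ c(2)] small_parity_coloring_reindex[OF F] 4(3)[OF nth_mem[OF c(1)]] by metis
next
  case (9 m' db us fs m t u v A As c cs)
  have "F u v \<noteq> g A"
  proof
    assume "F u v = g A"
    then have "realizes g F us m'" using 9 realizes_paint[OF F] by auto
    then show False using 9 by (auto simp: both_iff)
  qed
  then show ?case using 9 by (auto simp: both_iff)
next
  case (7 m' db us fs m t u v A As cs)
  have "F u v \<noteq> g A"
  proof
    assume "F u v = g A"
    then have "realizes g F us m'" using 7 realizes_paint[OF F] by auto
    \<comment> \<open>With \<open>uv\<close> painted truthfully the matrix has no even path, against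
      the verdict of the search.\<close>
    then show False using violated_False realizes_no_even_path[OF F] 7(4) by metis
  qed
  then show ?case using 7 by auto
qed auto

lemma check_from_sound:
  fixes F :: "vertex \<Rightarrow> vertex \<Rightarrow> 'c"
  assumes "small_parity_coloring F" "palette_split us fs"
    and db: "\<And>pat G. pat \<in> set db \<Longrightarrow> small_parity_coloring (G :: vertex \<Rightarrow> vertex \<Rightarrow> 'c) \<Longrightarrow> \<not> matches G pat"
    and "check_from pat us fs m t db c" "realizes g F us m"
    and "\<And>u v A. (u, v, A) \<in> set pat \<Longrightarrow> A \<in> set us \<and> F u v = g A"
  shows False
  using assms(2,4-)
proof (induction pat arbitrary: m t)
  case Nil
  then show ?case using check_sound(1)[OF assms(1) db] by simp
next
  case (Cons x pat)
  obtain u v A where x: "x = (u, v, A)" by (cases x)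
  then have "realizes g F us (paint m u v A)"
    using Cons.prems by (intro realizes_paint[OF assms(1)]) auto
  then show ?case
    using Cons.prems by (intro Cons.IH[of "paint m u v A" "join t u v A"]) (auto simp: x)
qed

text \<open>A pattern prescribes colors only up to renaming. Matching yields an injective
  interpretation of its names, under which the checker can start from the empty matrix and paint the
  pattern truthfully.\<close>

lemma refutes_sound:
  fixes F :: "vertex \<Rightarrow> vertex \<Rightarrow> 'c"
  assumes "refutes db pat c" "small_parity_coloring F"
    and db: "\<And>pat G. pat \<in> set db \<Longrightarrow> small_parity_coloring (G :: vertex \<Rightarrow> vertex \<Rightarrow> 'c) \<Longrightarrow> \<not> matches G pat"
  shows "\<not> matches F pat"
proof
  assume F: "matches F pat"
  define C where "C = snd ` snd ` set pat"
  define us where "us = filter (\<lambda>A. A \<in> C) palette"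
  have pal: "A \<in> set palette" if "(u, v, A) \<in> set pat" for u v A
    using assms(1) that by (auto simp: refutes_def list_all_iff)
  have us: "set us = C"
    using pal by (fastforce simp: us_def C_def)
  \<comment> \<open>The choice is unambiguous on the names of the pattern: by
    \<open>matches\<close>, all edges with the same name have one color.\<close>
  define g where "g A = (SOME x. \<exists>u v. (u, v, A) \<in> set pat \<and> x = F u v)" for A
  have g: "F u v = g A" if "(u, v, A) \<in> set pat" for u v A
  proof -
    have "\<exists>u' v'. (u', v', A) \<in> set pat \<and> g A = F u' v'"
      unfolding g_def by (rule someI_ex) (use that in blast)
    then show ?thesis using F that unfolding matches_def by fastforce
  qed
  have "inj_on g C"
    using F g unfolding inj_on_def C_def matches_def by fastforce
  moreover have "g ` C \<subseteq> range (case_prod F)"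
  proof
    fix x assume "x \<in> g ` C"
    then obtain u v A where "(u, v, A) \<in> set pat" "x = g A" by (auto simp: C_def)
    then have "x = case_prod F (u, v)" using g by simp
    then show "x \<in> range (case_prod F)" by blast
  qed
  moreover have "color_at no_color u v = None" for u v
    by (cases u; cases v) (simp_all add: color_at_def no_color_def const_row_def)
  ultimately have "realizes g F us no_color"
    by (simp add: realizes_def us)
  moreover have "palette_split us (filter (\<lambda>A. A \<notin> C) palette)"
    using palette(1) by (auto simp: palette_split_def us_def)
  moreover have "check_from pat us (filter (\<lambda>A. A \<notin> C) palette) no_color no_mate db c"
    using assms(1) by (simp add: refutes_def us_def C_def image_comp)
  moreover have "A \<in> set us \<and> F u v = g A" if "(u, v, A) \<in> set pat" for u v A
    using that g us unfolding C_def by force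
  ultimately show False
    using check_from_sound[OF assms(2) _ db] by blast
qed

section \<open>Certificates\<close>

text \<open>The entries use 7, 8, 9, 9, 10, 10, 10, 11, 11, 12 and 13 colors, that is, 6 down to 0
  agreeing opposite pairs. Names are numbered by first occurrence along \<open>K6\<close>; as a
  result the color on three edges is \<open>Low V0\<close>, \<open>Low V1\<close> or
  \<open>Low V2\<close>, depending on the entry.\<close>

definition clique_patterns :: "pattern list" where
  "clique_patterns = [
    clique_pattern [Low V0, Low V1, Low V2, Low V2, Low V1, Low V0, Low V3, Low V4, Low V5, Low V6, Low V4, Low V3, Low V6, Low V5, Low V0],
    clique_pattern [Low V0, Low V1, Low V2, Low V2, Low V1, Low V0, Low V3, Low V4, Low V5, Low V6, Low V4, Low V3, Low V6, Low V7, Low V0],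
    clique_pattern [Low V0, Low V1, Low V2, Low V2, Low V1, Low V0, Low V3, Low V4, Low V5, Low V6, Low V4, Low V3, Low V7, Low V8, Low V0],
    clique_pattern [Low V0, Low V1, Low V2, Low V2, Low V1, Low V0, Low V3, Low V4, Low V5, Low V6, Low V4, Low V7, Low V6, Low V8, Low V0],
    clique_pattern [Low V0, Low V1, Low V2, Low V2, Low V1, Low V0, Low V3, Low V4, Low V5, Low V6, Low V4, Low V7, Low V8, High V0, Low V0],
    clique_pattern [Low V0, Low V1, Low V2, Low V2, Low V1, Low V3, Low V4, Low V5, Low V6, Low V7, Low V6, Low V7, Low V8, High V0, Low V1],
    clique_pattern [Low V0, Low V1, Low V2, Low V2, Low V1, Low V3, Low V4, Low V5, Low V6, Low V7, Low V6, Low V8, High V0, Low V5, Low V1],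
    clique_pattern [Low V0, Low V1, Low V2, Low V2, Low V1, Low V0, Low V3, Low V4, Low V5, Low V6, Low V7, Low V8, High V0, High V1, Low V0],
    clique_pattern [Low V0, Low V1, Low V2, Low V2, Low V1, Low V3, Low V4, Low V5, Low V6, Low V7, Low V6, Low V8, High V0, High V1, Low V1],
    clique_pattern [Low V0, Low V1, Low V2, Low V2, Low V1, Low V3, Low V4, Low V5, Low V6, Low V7, Low V8, High V0, High V1, High V2, Low V1],
    clique_pattern [Low V0, Low V1, Low V2, Low V2, Low V3, Low V4, Low V5, Low V6, Low V7, Low V8, High V0, High V1, High V2, High V3, Low V2]]"

text \<open>The vertices 0 to 5 with bitwise sums as colors. Seven fresh colors must be placed
  before a leaf can close, which makes this the largest tree.\<close>

lemma refutes_clique0: "refutes [] (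
    clique_pattern [Low V0, Low V1, Low V2, Low V2, Low V1, Low V0, Low V3, Low V4, Low V5, Low V6, Low V4, Low V3, Low V6, Low V5, Low V0])
  (
    Branch V0 V6 [Branch V2 V6 [Branch V1 V6 [Branch V3 V6 [Branch V4 V6 [Branch V5 V6 [Branch V0 V8 [Branch V1 V8
    [Branch V2 V8 [], Branch V2 V8 [], Branch V4 V8 [], Branch V4 V8 [], Branch V2 V8 [Branch V3 V8 [Branch V4 V8
    [Branch V5 V8 [Branch V6 V8 [Branch V0 V7 [Branch V2 V7 [], Branch V2 V7 [], Branch V4 V7 [], Branch V4 V7 [],
    Branch V6 V7 [], Branch V6 V7 []]], Branch V4 V7 [], Branch V4 V7 []], Branch V4 V7 [], Branch V4 V7 []], Branch
    V2 V7 [], Branch V2 V7 []], Branch V7 V8 [], Branch V7 V8 []], Branch V6 V8 [Branch V0 V7 []], Branch V6 V8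
    [Branch V0 V7 []]], Branch V2 V8 [Branch V3 V8 []], Branch V2 V8 [Branch V3 V8 []], Branch V4 V8 [Branch V5 V8
    []], Branch V1 V8 [Branch V2 V8 [Branch V3 V8 [Branch V4 V8 [Branch V5 V8 [Branch V6 V8 [Branch V0 V7 [Branch V2
    V7 [], Branch V2 V7 [], Branch V4 V7 [], Branch V4 V7 [], Branch V6 V7 [], Branch V6 V7 []]], Branch V4 V7 [],
    Branch V4 V7 []], Branch V4 V7 [], Branch V4 V7 []], Branch V2 V7 [], Branch V2 V7 []], Branch V7 V8 [], Branch V7
    V8 []], Branch V2 V8 [Branch V3 V8 [Branch V4 V8 [Branch V5 V8 [Branch V6 V8 [Branch V2 V7 [Branch V0 V7 [],
    Branch V0 V7 [], Branch V4 V7 [], Branch V4 V7 [], Branch V6 V7 [], Branch V6 V7 []]], Branch V4 V7 [], Branch V4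
    V7 []], Branch V4 V7 [], Branch V4 V7 []], Branch V3 V7 [], Branch V3 V7 []], Branch V3 V8 [Branch V4 V8 [Branch
    V5 V8 [Branch V6 V8 [Branch V2 V7 [Branch V0 V7 [], Branch V0 V7 [], Branch V4 V7 [], Branch V4 V7 [], Branch V6
    V7 [], Branch V6 V7 []]], Branch V4 V7 [], Branch V4 V7 []], Branch V4 V7 [], Branch V4 V7 []], Branch V4 V8
    [Branch V5 V8 [Branch V6 V8 [Branch V4 V7 [Branch V0 V7 [], Branch V2 V7 [], Branch V0 V7 [], Branch V2 V7 [],
    Branch V6 V7 [], Branch V6 V7 []]], Branch V4 V7 [], Branch V4 V7 []], Branch V5 V8 [Branch V6 V8 [Branch V4 V7
    [Branch V0 V7 [], Branch V2 V7 [], Branch V0 V7 [], Branch V2 V7 [], Branch V6 V7 [], Branch V6 V7 []]], Branch V6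
    V8 [Branch V0 V7 [Branch V2 V7 [], Branch V2 V7 [], Branch V4 V7 [], Branch V4 V7 [], Branch V6 V7 [], Branch V6
    V7 []], Branch V0 V7 [Branch V1 V7 [Branch V2 V7 [], Branch V2 V7 [], Branch V4 V7 [], Branch V4 V7 [], Branch V6
    V7 [], Branch V6 V7 []], Branch V2 V7 [Branch V3 V7 []], Branch V2 V7 [Branch V3 V7 []], Branch V4 V7 [Branch V5
    V7 []], Branch V4 V7 [Branch V5 V7 []], Branch V6 V7 [Branch V7 V8 []], Branch V6 V7 [Branch V7 V8 []]]], Branch
    V4 V7 [Branch V5 V7 []], Branch V4 V7 [Branch V5 V7 []]], Branch V4 V7 [Branch V5 V7 []], Branch V4 V7 [Branch V5
    V7 []]], Branch V2 V7 [Branch V3 V7 []], Branch V2 V7 [Branch V3 V7 []]], Branch V2 V7 [Branch V6 V7 []], Branch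
    V2 V7 [Branch V6 V7 []]], Branch V0 V7 [Branch V7 V8 []], Branch V0 V7 [Branch V7 V8 []]], Branch V4 V8 [Branch V5
    V8 []], Branch V6 V8 [Branch V1 V8 [Branch V1 V7 [], Branch V2 V8 [Branch V4 V7 [], Branch V3 V8 [Branch V0 V7 [],
    Branch V4 V8 [Branch V0 V7 [], Branch V5 V8 [Branch V0 V7 [], Branch V0 V7 [Branch V1 V7 [], Branch V2 V7 [],
    Branch V3 V7 [], Branch V4 V7 [], Branch V7 V8 [], Branch V5 V7 [], Branch V6 V7 []]]]]]], Branch V1 V7 [Branch V7
    V8 []]], Branch V6 V8 [Branch V1 V8 [Branch V1 V7 [], Branch V2 V8 [Branch V4 V7 [], Branch V3 V8 [Branch V0 V7
    [], Branch V4 V8 [Branch V0 V7 [], Branch V5 V8 [Branch V0 V7 [], Branch V0 V7 [Branch V1 V7 [], Branch V3 V7 [],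
    Branch V2 V7 [], Branch V5 V7 [], Branch V7 V8 [], Branch V4 V7 [], Branch V6 V7 []]]]]]], Branch V1 V7 [Branch V7
    V8 []]]], Branch V4 V8 [Branch V6 V7 [Branch V4 V7 [Branch V0 V8 []], Branch V0 V7 [Branch V1 V7 []], Branch V0 V8
    [Branch V1 V8 []]], Branch V0 V7 [Branch V1 V7 [Branch V2 V7 []]]], Branch V4 V8 [Branch V6 V7 [Branch V4 V7
    [Branch V0 V8 []], Branch V0 V7 [Branch V1 V7 []], Branch V0 V8 [Branch V1 V8 []]], Branch V0 V7 [Branch V1 V7
    [Branch V2 V7 []]]]], Branch V5 V7 [Branch V6 V8 [Branch V5 V8 [Branch V4 V7 [Branch V0 V7 [], Branch V0 V7 [],
    Branch V0 V8 []], Branch V0 V7 [Branch V1 V7 []]], Branch V0 V8 [Branch V6 V7 [Branch V1 V8 []]], Branch V6 V7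
    [Branch V0 V7 [Branch V1 V7 []]]], Branch V0 V8 [Branch V1 V8 [Branch V2 V8 [Branch V3 V8 []]]]], Branch V5 V7
    [Branch V6 V8 [Branch V5 V8 [Branch V4 V7 [Branch V0 V7 [], Branch V0 V7 [], Branch V0 V8 []], Branch V0 V7
    [Branch V1 V7 []]], Branch V0 V8 [Branch V6 V7 [Branch V1 V8 []]], Branch V6 V7 [Branch V0 V7 [Branch V1 V7 []]]],
    Branch V0 V8 [Branch V1 V8 [Branch V2 V8 [Branch V3 V8 []]]]]], Branch V2 V8 [Branch V6 V7 [Branch V2 V7 [Branch
    V4 V7 [Branch V5 V7 [Branch V3 V7 [], Branch V0 V8 []], Branch V3 V7 [Branch V5 V7 []], Branch V1 V8 [Branch V4 V8
    []]], Branch V0 V8 [Branch V1 V8 [Branch V3 V8 []]]], Branch V0 V7 [Branch V1 V7 [Branch V2 V7 [Branch V4 V7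
    []]]], Branch V6 V8 [Branch V0 V8 [Branch V1 V8 [Branch V4 V8 []]]]], Branch V0 V7 [Branch V1 V7 [Branch V2 V7
    [Branch V3 V7 [Branch V4 V7 []]]]]], Branch V2 V8 [Branch V6 V7 [Branch V2 V7 [Branch V4 V7 [Branch V5 V7 [Branch
    V3 V7 [], Branch V1 V8 []], Branch V3 V7 [Branch V5 V7 []], Branch V0 V8 [Branch V4 V8 []]], Branch V0 V8 [Branch
    V1 V8 [Branch V3 V8 []]]], Branch V0 V7 [Branch V1 V7 [Branch V2 V7 [Branch V4 V7 []]]], Branch V6 V8 [Branch V0
    V8 [Branch V1 V8 [Branch V4 V8 []]]]], Branch V0 V7 [Branch V1 V7 [Branch V2 V7 [Branch V3 V7 [Branch V4 V7
    []]]]]]], Branch V0 V7 [Branch V6 V7 [Branch V2 V7 [Branch V4 V7 [Branch V3 V7 [Branch V5 V7 [Branch V0 V8 []],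
    Branch V1 V8 [Branch V6 V8 []], Branch V0 V8 [Branch V2 V8 []]], Branch V0 V8 [Branch V2 V8 [Branch V4 V8 []]]],
    Branch V0 V8 [Branch V3 V8 [Branch V2 V8 [Branch V4 V8 []]]]], Branch V0 V8 [Branch V1 V8 [Branch V7 V8 [Branch V6
    V8 [Branch V3 V6 [Branch V2 V8 []]], Branch V3 V6 [Branch V4 V6 [Branch V5 V6 []]]], Branch V3 V6 [Branch V4 V6
    [Branch V5 V6 [Branch V2 V7 []]]]]]], Branch V0 V8 [Branch V1 V8 [Branch V2 V8 [Branch V3 V8 [Branch V4 V8 [Branch
    V5 V8 []]]]]]], Branch V0 V7 [Branch V6 V7 [Branch V2 V7 [Branch V5 V7 [Branch V3 V7 [Branch V4 V7 [Branch V0 V8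
    []], Branch V1 V8 [Branch V6 V8 []], Branch V0 V8 [Branch V2 V8 []]], Branch V0 V8 [Branch V2 V8 [Branch V4 V8
    []]]], Branch V0 V8 [Branch V3 V8 [Branch V2 V8 [Branch V4 V8 []]]]], Branch V0 V8 [Branch V1 V8 [Branch V7 V8
    [Branch V6 V8 [Branch V3 V6 [Branch V2 V8 []]], Branch V3 V6 [Branch V4 V6 [Branch V5 V6 []]]], Branch V3 V6
    [Branch V4 V6 [Branch V5 V6 [Branch V2 V7 []]]]]]], Branch V0 V8 [Branch V1 V8 [Branch V2 V8 [Branch V3 V8 [Branch
    V4 V8 [Branch V5 V8 []]]]]]]], Branch V3 V7 [Branch V4 V7 [Branch V6 V7 [Branch V0 V7 [Branch V5 V7 [Branch V1 V7
    [Branch V2 V7 [Branch V3 V6 [Branch V0 V8 []]], Branch V2 V8 [Branch V6 V8 [], Branch V1 V6 [Branch V5 V6 []]],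
    Branch V0 V8 [Branch V3 V8 []]], Branch V3 V8 [Branch V0 V8 [Branch V4 V8 []]]], Branch V1 V8 [Branch V3 V8
    [Branch V0 V8 [Branch V4 V8 []]]]], Branch V3 V8 [Branch V2 V8 [Branch V7 V8 [Branch V6 V8 [Branch V1 V6 [Branch
    V0 V8 []]], Branch V1 V6 [Branch V3 V6 [Branch V4 V6 []]]], Branch V1 V6 [Branch V4 V6 [Branch V3 V6 [Branch V5 V6
    []]]]]]], Branch V3 V8 [Branch V5 V8 [Branch V0 V8 [Branch V1 V8 [Branch V4 V8 [Branch V7 V8 []]]]]]], Branch V0
    V8 [Branch V1 V8 [Branch V2 V8 [Branch V3 V8 [Branch V4 V8 [Branch V5 V8 [Branch V6 V8 []]]]]]]], Branch V3 V7
    [Branch V5 V7 [Branch V6 V7 [Branch V0 V7 [Branch V4 V7 [Branch V1 V7 [Branch V2 V7 [Branch V3 V6 [Branch V0 V8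
    []]], Branch V2 V8 [Branch V6 V8 [], Branch V1 V6 [Branch V4 V6 []]], Branch V0 V8 [Branch V3 V8 []]], Branch V3
    V8 [Branch V0 V8 [Branch V4 V8 []]]], Branch V1 V8 [Branch V3 V8 [Branch V0 V8 [Branch V5 V8 []]]]], Branch V3 V8
    [Branch V2 V8 [Branch V7 V8 [Branch V6 V8 [Branch V1 V6 [Branch V0 V8 []]], Branch V1 V6 [Branch V3 V6 [Branch V4
    V6 []]]], Branch V1 V6 [Branch V4 V6 [Branch V3 V6 [Branch V5 V6 []]]]]]], Branch V3 V8 [Branch V4 V8 [Branch V0
    V8 [Branch V1 V8 [Branch V5 V8 [Branch V7 V8 []]]]]]], Branch V0 V8 [Branch V1 V8 [Branch V2 V8 [Branch V3 V8
    [Branch V4 V8 [Branch V5 V8 [Branch V6 V8 []]]]]]]]], Branch V6 V7 [Branch V1 V7 [Branch V2 V7 [Branch V3 V7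
    [Branch V4 V7 [Branch V5 V7 [Branch V0 V7 [Branch V1 V6 [Branch V1 V8 [], Branch V2 V6 [Branch V4 V8 [], Branch V3
    V6 [Branch V0 V8 [], Branch V4 V6 [Branch V0 V8 [], Branch V5 V6 [Branch V0 V8 [], Branch V0 V8 [Branch V2 V8 [],
    Branch V3 V8 [], Branch V4 V8 [], Branch V5 V8 [], Branch V6 V8 [], Branch V1 V8 [], Branch V7 V8 []]]]]]], Branch
    V2 V8 [Branch V1 V6 [Branch V0 V8 []], Branch V1 V6 [Branch V2 V6 []]]], Branch V1 V8 [Branch V3 V8 [Branch V4 V8
    []]]], Branch V1 V8 [Branch V5 V8 [Branch V2 V8 [Branch V4 V8 []]]]], Branch V1 V8 [Branch V2 V8 [Branch V3 V8
    [Branch V4 V8 [Branch V5 V8 []]]]]], Branch V1 V8 [Branch V3 V8 [Branch V2 V8 [Branch V4 V8 [Branch V5 V8 [Branch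
    V7 V8 []]]]]]], Branch V0 V8 [Branch V1 V8 [Branch V2 V8 [Branch V3 V8 [Branch V4 V8 [Branch V5 V8 [Branch V6 V8
    []]]]]]]], Branch V1 V8 [Branch V6 V8 [Branch V2 V8 [Branch V3 V8 [Branch V4 V8 [Branch V0 V8 [Branch V7 V8
    [Branch V5 V8 [], Branch V1 V6 [Branch V2 V6 []]], Branch V2 V6 [Branch V1 V6 [Branch V3 V6 []]]]]]]]]], Branch V6
    V7 [Branch V1 V7 [Branch V2 V7 [Branch V3 V7 [Branch V4 V7 [Branch V5 V7 [Branch V0 V7 [Branch V1 V6 [Branch V1 V8
    [], Branch V2 V6 [Branch V4 V8 [], Branch V3 V6 [Branch V0 V8 [], Branch V4 V6 [Branch V0 V8 [], Branch V5 V6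
    [Branch V0 V8 [], Branch V0 V8 [Branch V3 V8 [], Branch V2 V8 [], Branch V5 V8 [], Branch V4 V8 [], Branch V6 V8
    [], Branch V1 V8 [], Branch V7 V8 []]]]]]], Branch V2 V8 [Branch V1 V6 [Branch V0 V8 []], Branch V1 V6 [Branch V2
    V6 []]]], Branch V1 V8 [Branch V2 V8 [Branch V4 V8 []]]], Branch V1 V8 [Branch V5 V8 [Branch V3 V8 [Branch V4 V8
    []]]]], Branch V1 V8 [Branch V2 V8 [Branch V3 V8 [Branch V4 V8 [Branch V5 V8 []]]]]], Branch V1 V8 [Branch V3 V8
    [Branch V2 V8 [Branch V4 V8 [Branch V5 V8 [Branch V7 V8 []]]]]]], Branch V0 V8 [Branch V1 V8 [Branch V2 V8 [Branch
    V3 V8 [Branch V4 V8 [Branch V5 V8 [Branch V6 V8 []]]]]]]], Branch V1 V8 [Branch V6 V8 [Branch V2 V8 [Branch V3 V8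
    [Branch V4 V8 [Branch V0 V8 [Branch V7 V8 [Branch V5 V8 [], Branch V1 V6 [Branch V2 V6 []]], Branch V2 V6 [Branch
    V1 V6 [Branch V3 V6 []]]]]]]]]]])"
  by code_simp

lemma refutes_clique1: "refutes [] (
    clique_pattern [Low V0, Low V1, Low V2, Low V2, Low V1, Low V0, Low V3, Low V4, Low V5, Low V6, Low V4, Low V3, Low V6, Low V7, Low V0])
  (
    Branch V2 V6 [Branch V4 V6 [Branch V3 V6 [Branch V0 V6 [Branch V1 V6 [Branch V5 V6 [Branch V3 V7 [Branch V0 V7 [],
    Branch V4 V7 [], Branch V4 V7 [], Branch V0 V7 [], Branch V2 V7 [Branch V4 V7 [Branch V5 V7 [Branch V6 V7 [Branch
    V2 V8 [Branch V0 V8 [], Branch V4 V8 [], Branch V4 V8 [], Branch V0 V8 [], Branch V6 V8 [], Branch V6 V8 []]],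
    Branch V4 V8 [], Branch V4 V8 []], Branch V4 V8 [], Branch V4 V8 []], Branch V3 V8 [], Branch V3 V8 []], Branch V6
    V7 [Branch V2 V8 []], Branch V6 V7 [Branch V2 V8 []]], Branch V4 V7 [Branch V6 V7 [Branch V4 V8 []], Branch V0 V8
    [Branch V1 V8 []]], Branch V4 V7 [Branch V6 V7 [Branch V4 V8 []], Branch V0 V8 [Branch V1 V8 []]]], Branch V4 V7
    [Branch V2 V8 [Branch V4 V8 [Branch V0 V7 []], Branch V0 V7 [Branch V1 V7 []], Branch V2 V7 [Branch V3 V7 [],
    Branch V1 V7 [Branch V3 V7 []]], Branch V0 V7 [Branch V5 V7 []]], Branch V0 V8 [Branch V3 V8 [Branch V4 V8 []]]],
    Branch V0 V7 [Branch V0 V8 [Branch V4 V7 [Branch V1 V7 [], Branch V2 V8 []], Branch V1 V7 [Branch V2 V7 []]],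
    Branch V0 V8 [Branch V1 V8 [Branch V2 V8 []]]], Branch V6 V8 [Branch V6 V7 [Branch V4 V7 [Branch V3 V7 [], Branch
    V4 V8 []], Branch V2 V8 [Branch V3 V8 []], Branch V5 V6 [Branch V2 V7 []]], Branch V3 V7 [Branch V2 V7 [Branch V4
    V7 []]], Branch V5 V6 [Branch V0 V8 [Branch V1 V8 []]]]], Branch V4 V8 [Branch V6 V8 [Branch V4 V7 [Branch V6 V7
    [Branch V2 V7 [], Branch V2 V8 [], Branch V1 V6 []], Branch V5 V7 [Branch V2 V8 []], Branch V1 V8 [Branch V3 V8
    []]], Branch V2 V7 [Branch V3 V7 [Branch V4 V7 []]], Branch V1 V6 [Branch V5 V6 [Branch V0 V8 []]]], Branch V1 V7
    [Branch V3 V7 [Branch V2 V7 [Branch V4 V7 [], Branch V1 V6 [Branch V5 V6 []]]]]], Branch V1 V8 [Branch V1 V7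
    [Branch V6 V8 [Branch V4 V8 [Branch V0 V7 [], Branch V2 V7 []], Branch V2 V8 [Branch V3 V8 []], Branch V2 V7
    [Branch V6 V7 [], Branch V5 V6 [Branch V0 V7 []]]], Branch V0 V8 [Branch V2 V8 [Branch V3 V8 []]]], Branch V0 V7
    [Branch V1 V7 [Branch V2 V7 [Branch V3 V7 []]]]], Branch V4 V8 [Branch V6 V8 [Branch V4 V7 [Branch V6 V7 [Branch
    V3 V7 [], Branch V3 V8 [], Branch V1 V6 []], Branch V3 V7 [Branch V3 V8 []], Branch V1 V8 [Branch V5 V8 []]],
    Branch V3 V7 [Branch V4 V7 [Branch V5 V7 []]], Branch V1 V6 [Branch V5 V6 [Branch V0 V8 []]]], Branch V5 V7
    [Branch V4 V7 [Branch V2 V7 [Branch V1 V7 [], Branch V1 V6 [Branch V1 V7 []]]]]]], Branch V2 V7 [Branch V6 V7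
    [Branch V4 V7 [Branch V5 V7 [Branch V1 V7 [Branch V0 V8 []], Branch V3 V8 [Branch V6 V8 []], Branch V0 V8 [Branch
    V1 V8 []]], Branch V2 V8 [Branch V0 V8 [Branch V1 V8 []]]], Branch V2 V8 [Branch V3 V8 [Branch V7 V8 [Branch V6 V8
    [], Branch V0 V6 [Branch V1 V6 []]], Branch V0 V6 [Branch V1 V6 [Branch V5 V6 []]]]]], Branch V0 V8 [Branch V1 V8
    [Branch V2 V8 [Branch V3 V8 [Branch V4 V8 []]]]]], Branch V2 V7 [Branch V6 V7 [Branch V4 V7 [Branch V5 V7 [Branch
    V0 V7 [Branch V0 V8 []], Branch V3 V8 [Branch V6 V8 []], Branch V0 V8 [Branch V1 V8 []]], Branch V2 V8 [Branch V0
    V8 [Branch V1 V8 []]]], Branch V2 V8 [Branch V3 V8 [Branch V7 V8 [Branch V6 V8 [], Branch V0 V6 [Branch V1 V6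
    []]], Branch V0 V6 [Branch V1 V6 [Branch V5 V6 []]]]]], Branch V0 V8 [Branch V1 V8 [Branch V2 V8 [Branch V3 V8
    [Branch V4 V8 []]]]]]], Branch V5 V7 [Branch V2 V7 [Branch V6 V7 [Branch V0 V7 [Branch V3 V7 [Branch V1 V7 [Branch
    V0 V8 [], Branch V5 V8 []], Branch V4 V8 [Branch V6 V8 []], Branch V0 V8 [Branch V1 V8 []]], Branch V1 V8 [Branch
    V0 V8 [Branch V2 V8 []]]], Branch V5 V8 [Branch V4 V8 [Branch V7 V8 [Branch V6 V8 [], Branch V0 V6 [Branch V1 V6
    []]], Branch V0 V6 [Branch V1 V6 [Branch V3 V6 []]]]]], Branch V3 V8 [Branch V5 V8 [Branch V0 V8 [Branch V1 V8
    [Branch V2 V8 []]]]]], Branch V0 V8 [Branch V1 V8 [Branch V2 V8 [Branch V3 V8 [Branch V4 V8 [Branch V5 V8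
    []]]]]]], Branch V5 V7 [Branch V1 V7 [Branch V6 V7 [Branch V2 V7 [Branch V3 V7 [Branch V0 V7 [Branch V1 V8 [],
    Branch V5 V8 []], Branch V4 V8 [Branch V6 V8 []], Branch V0 V8 [Branch V1 V8 []]], Branch V3 V8 [Branch V1 V8
    [Branch V2 V8 []]]], Branch V5 V8 [Branch V4 V8 [Branch V7 V8 [Branch V6 V8 [], Branch V0 V6 [Branch V1 V6 []]],
    Branch V0 V6 [Branch V1 V6 [Branch V3 V6 []]]]]], Branch V0 V8 [Branch V5 V8 [Branch V1 V8 [Branch V2 V8 [Branch
    V3 V8 []]]]]], Branch V0 V8 [Branch V1 V8 [Branch V2 V8 [Branch V3 V8 [Branch V4 V8 [Branch V5 V8 []]]]]]]],
    Branch V6 V7 [Branch V3 V7 [Branch V0 V7 [Branch V5 V7 [Branch V4 V7 [Branch V1 V7 [Branch V2 V7 [Branch V3 V6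
    [Branch V0 V8 []]], Branch V0 V8 [Branch V5 V8 []], Branch V0 V8 [Branch V3 V8 [], Branch V3 V6 [Branch V5 V6
    []]]], Branch V3 V8 [Branch V0 V8 [Branch V4 V8 []]]], Branch V3 V8 [Branch V4 V8 [Branch V0 V8 [Branch V1 V8
    []]]]], Branch V1 V8 [Branch V3 V8 [Branch V0 V8 [Branch V4 V8 [Branch V5 V8 []]]]]], Branch V0 V8 [Branch V1 V8
    [Branch V2 V8 [Branch V3 V8 [Branch V4 V8 [Branch V5 V8 []]]]]]], Branch V3 V8 [Branch V6 V8 [Branch V0 V8 [Branch
    V1 V8 [Branch V4 V8 [Branch V2 V8 [Branch V5 V8 [], Branch V0 V6 [Branch V1 V6 []]]]]]]]], Branch V6 V7 [Branch V3
    V7 [Branch V1 V7 [Branch V5 V7 [Branch V4 V7 [Branch V0 V7 [Branch V2 V7 [Branch V3 V6 [Branch V0 V8 []]], Branch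
    V1 V8 [Branch V5 V8 []], Branch V1 V8 [Branch V3 V8 [], Branch V3 V6 [Branch V5 V6 []]]], Branch V3 V8 [Branch V1
    V8 [Branch V4 V8 []]]], Branch V3 V8 [Branch V4 V8 [Branch V0 V8 [Branch V1 V8 []]]]], Branch V0 V8 [Branch V3 V8
    [Branch V1 V8 [Branch V4 V8 [Branch V5 V8 []]]]]], Branch V0 V8 [Branch V1 V8 [Branch V2 V8 [Branch V3 V8 [Branch
    V4 V8 [Branch V5 V8 []]]]]]], Branch V3 V8 [Branch V6 V8 [Branch V0 V8 [Branch V1 V8 [Branch V4 V8 [Branch V2 V8
    [Branch V5 V8 [], Branch V0 V6 [Branch V1 V6 []]]]]]]]]])"
  by code_simp

lemma refutes_clique2: "refutes [] (
    clique_pattern [Low V0, Low V1, Low V2, Low V2, Low V1, Low V0, Low V3, Low V4, Low V5, Low V6, Low V4, Low V3, Low V7, Low V8, Low V0])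
  (
    Branch V2 V8 [Branch V4 V8 [Branch V5 V8 [Branch V0 V8 [Branch V1 V8 [Branch V3 V8 [Branch V2 V6 [Branch V0 V7
    []], Branch V2 V6 [Branch V0 V7 []]], Branch V2 V6 [Branch V2 V7 [Branch V0 V6 []], Branch V0 V7 [Branch V2 V7
    []]], Branch V2 V6 [Branch V2 V7 [Branch V0 V6 []], Branch V0 V7 [Branch V2 V7 []]], Branch V2 V6 [Branch V2 V7
    [Branch V0 V6 []], Branch V0 V7 [Branch V2 V7 []]], Branch V2 V6 [Branch V2 V7 [Branch V0 V6 []], Branch V0 V7
    [Branch V2 V7 []]]], Branch V2 V7 [Branch V4 V6 [Branch V2 V6 [Branch V1 V7 []], Branch V0 V6 [Branch V1 V6 []],
    Branch V3 V7 [Branch V5 V7 [], Branch V0 V6 [Branch V1 V6 []]], Branch V1 V7 [Branch V3 V7 []]], Branch V1 V6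
    [Branch V2 V6 [Branch V5 V6 []]]], Branch V2 V7 [Branch V6 V8 [Branch V2 V6 [Branch V3 V7 []], Branch V2 V6
    [Branch V4 V7 []], Branch V3 V7 [Branch V4 V7 []], Branch V2 V6 [Branch V5 V6 []]], Branch V3 V6 [Branch V1 V6
    [Branch V2 V6 []]]], Branch V2 V7 [Branch V5 V6 [Branch V2 V6 [Branch V1 V7 []], Branch V0 V6 [Branch V1 V6 []],
    Branch V3 V7 [Branch V4 V7 [], Branch V0 V6 [Branch V1 V6 []]], Branch V1 V7 [Branch V3 V7 []]], Branch V1 V6
    [Branch V2 V6 [Branch V4 V6 []]]], Branch V2 V7 [Branch V6 V8 [Branch V2 V6 [Branch V3 V7 []], Branch V2 V6
    [Branch V5 V7 []], Branch V3 V7 [Branch V4 V7 []], Branch V2 V6 [Branch V4 V6 []]], Branch V3 V6 [Branch V1 V6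
    [Branch V2 V6 []]]]], Branch V4 V7 [Branch V7 V8 [Branch V4 V6 [Branch V2 V7 [Branch V0 V6 [], Branch V0 V6 []],
    Branch V2 V7 [Branch V2 V6 [Branch V0 V7 []]], Branch V0 V7 [Branch V1 V7 []]], Branch V4 V6 [Branch V5 V6 [Branch
    V6 V8 [], Branch V0 V6 [Branch V1 V6 []]]]], Branch V0 V6 [Branch V1 V6 [Branch V2 V6 [Branch V3 V6 []]]]], Branch
    V4 V7 [Branch V7 V8 [Branch V4 V6 [Branch V2 V7 [Branch V1 V6 [], Branch V0 V6 []], Branch V2 V7 [Branch V2 V6
    [Branch V0 V7 []]], Branch V0 V7 [Branch V1 V7 []]], Branch V4 V6 [Branch V5 V6 [Branch V6 V8 [], Branch V0 V6
    [Branch V1 V6 []]]]], Branch V0 V6 [Branch V1 V6 [Branch V2 V6 [Branch V3 V6 []]]]]], Branch V5 V6 [Branch V5 V7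
    [Branch V2 V6 [Branch V2 V7 [Branch V4 V6 [Branch V0 V6 [], Branch V6 V8 [], Branch V0 V7 []], Branch V0 V6
    [Branch V1 V6 []], Branch V0 V6 [Branch V1 V6 []]], Branch V0 V7 [Branch V0 V6 [Branch V1 V6 []]], Branch V3 V7
    [Branch V0 V7 [Branch V1 V7 []]]], Branch V0 V6 [Branch V1 V6 [Branch V2 V6 [Branch V3 V6 []]]]], Branch V0 V7
    [Branch V1 V7 [Branch V4 V7 [Branch V2 V7 [Branch V3 V7 []]]]]], Branch V5 V6 [Branch V5 V7 [Branch V2 V6 [Branch
    V2 V7 [Branch V4 V6 [Branch V0 V6 [], Branch V6 V8 [], Branch V0 V7 []], Branch V0 V6 [Branch V1 V6 []], Branch V0
    V6 [Branch V1 V6 []]], Branch V1 V7 [Branch V0 V6 [Branch V1 V6 []]], Branch V3 V7 [Branch V0 V7 [Branch V1 V7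
    []]]], Branch V0 V6 [Branch V1 V6 [Branch V2 V6 [Branch V3 V6 []]]]], Branch V0 V7 [Branch V1 V7 [Branch V4 V7
    [Branch V2 V7 [Branch V3 V7 []]]]]]], Branch V6 V8 [Branch V3 V6 [Branch V4 V6 [Branch V5 V6 [Branch V0 V6 [Branch
    V1 V6 [Branch V0 V7 [], Branch V3 V7 []], Branch V1 V7 [Branch V3 V7 [], Branch V0 V7 [Branch V2 V7 []]], Branch
    V1 V7 [Branch V4 V7 []]], Branch V3 V7 [Branch V0 V7 [Branch V1 V7 []]]], Branch V3 V7 [Branch V5 V7 [Branch V0 V7
    [Branch V1 V7 []]]]], Branch V0 V7 [Branch V1 V7 [Branch V2 V7 [Branch V3 V7 [Branch V6 V7 []]]]]], Branch V3 V7
    [Branch V7 V8 [Branch V2 V7 [Branch V6 V7 [Branch V0 V7 [Branch V1 V7 []], Branch V0 V6 [Branch V1 V6 [Branch V2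
    V6 []]]], Branch V0 V6 [Branch V1 V6 [Branch V2 V6 [Branch V3 V6 []]]]]]]], Branch V6 V8 [Branch V3 V6 [Branch V4
    V6 [Branch V5 V6 [Branch V0 V6 [Branch V1 V6 [Branch V3 V7 [], Branch V0 V7 []], Branch V1 V7 [Branch V5 V7 []],
    Branch V1 V7 [Branch V3 V7 [], Branch V0 V7 [Branch V2 V7 []]]], Branch V3 V7 [Branch V0 V7 [Branch V1 V7 []]]],
    Branch V3 V7 [Branch V5 V7 [Branch V0 V7 [Branch V1 V7 []]]]], Branch V0 V7 [Branch V1 V7 [Branch V2 V7 [Branch V3
    V7 [Branch V6 V7 []]]]]], Branch V3 V7 [Branch V7 V8 [Branch V2 V7 [Branch V6 V7 [Branch V0 V7 [Branch V1 V7 []],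
    Branch V0 V6 [Branch V1 V6 [Branch V2 V6 []]]], Branch V0 V6 [Branch V1 V6 [Branch V2 V6 [Branch V3 V6 []]]]]]]]])"
  by code_simp

lemma refutes_clique3: "refutes [] (
    clique_pattern [Low V0, Low V1, Low V2, Low V2, Low V1, Low V0, Low V3, Low V4, Low V5, Low V6, Low V4, Low V7, Low V6, Low V8, Low V0])
  (
    Branch V4 V8 [Branch V4 V7 [Branch V1 V7 [Branch V0 V7 [Branch V3 V7 [Branch V2 V7 [Branch V5 V7 [], Branch V4 V6
    [Branch V1 V8 []], Branch V4 V6 [Branch V0 V8 []], Branch V4 V6 [Branch V3 V8 []]], Branch V2 V7 [Branch V5 V7
    []], Branch V4 V6 [Branch V3 V6 [Branch V0 V6 [], Branch V0 V8 [], Branch V0 V6 []], Branch V1 V8 [Branch V2 V8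
    []]], Branch V2 V8 [Branch V7 V8 [Branch V2 V6 []], Branch V0 V6 [Branch V1 V6 []]], Branch V4 V6 [Branch V3 V6
    [Branch V2 V6 [], Branch V0 V6 [], Branch V0 V8 []], Branch V2 V8 [Branch V5 V8 []]]], Branch V2 V7 [Branch V3 V7
    [Branch V5 V7 []]], Branch V2 V6 [Branch V1 V8 [Branch V2 V8 [Branch V1 V6 []], Branch V0 V6 [Branch V1 V6 []],
    Branch V3 V6 [Branch V4 V6 []], Branch V3 V6 [Branch V4 V6 []]], Branch V1 V6 [Branch V0 V6 [Branch V3 V6 []]],
    Branch V1 V8 [Branch V2 V8 [Branch V3 V8 []]]], Branch V1 V8 [Branch V3 V8 [Branch V7 V8 [Branch V1 V6 []], Branch
    V1 V6 [Branch V2 V6 []]], Branch V0 V6 [Branch V1 V6 [Branch V2 V6 []]]], Branch V7 V8 [Branch V5 V8 [Branch V2 V8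
    [Branch V2 V6 []], Branch V0 V6 [Branch V4 V6 [], Branch V1 V6 [Branch V2 V6 []]], Branch V1 V6 [Branch V2 V6
    []]], Branch V3 V6 [Branch V4 V6 [Branch V5 V6 []]], Branch V2 V7 [Branch V3 V7 [Branch V5 V7 []]]]], Branch V2 V7
    [Branch V2 V8 [Branch V0 V7 [Branch V3 V7 []]]], Branch V7 V8 [Branch V3 V8 [Branch V4 V6 [Branch V3 V6 [Branch V1
    V6 [Branch V0 V6 []], Branch V1 V6 [], Branch V0 V8 []], Branch V1 V6 [Branch V2 V6 []], Branch V5 V6 [Branch V5
    V8 []], Branch V0 V8 [Branch V2 V8 []]], Branch V2 V6 [Branch V6 V8 [Branch V3 V6 [], Branch V0 V6 [Branch V1 V6
    []]]]], Branch V2 V6 [Branch V4 V6 [Branch V3 V6 [Branch V5 V6 []]]], Branch V2 V7 [Branch V3 V7 [Branch V0 V7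
    [Branch V5 V7 []]]]], Branch V0 V8 [Branch V0 V6 [Branch V4 V6 [Branch V2 V6 [Branch V1 V6 [], Branch V1 V6 [],
    Branch V2 V8 []], Branch V1 V6 [Branch V2 V6 []], Branch V2 V8 [Branch V3 V8 []]], Branch V3 V6 [Branch V1 V6
    [Branch V2 V6 []]], Branch V1 V8 [Branch V2 V8 [Branch V3 V8 []]]], Branch V0 V6 [Branch V1 V6 [Branch V2 V6
    [Branch V3 V6 []]]]], Branch V3 V8 [Branch V4 V6 [Branch V3 V6 [Branch V5 V7 [Branch V1 V6 [Branch V0 V8 []],
    Branch V1 V6 [Branch V0 V6 []], Branch V1 V6 [Branch V0 V6 [], Branch V0 V6 [], Branch V0 V8 []]], Branch V0 V6
    [Branch V1 V6 []], Branch V0 V8 [Branch V2 V8 []]], Branch V0 V6 [Branch V1 V6 [Branch V2 V6 []]], Branch V5 V8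
    [Branch V0 V8 [Branch V2 V8 []]]], Branch V0 V6 [Branch V4 V6 [Branch V2 V6 [Branch V3 V6 []]]]]], Branch V5 V8
    [Branch V0 V8 [Branch V7 V8 [Branch V1 V8 [Branch V2 V8 [Branch V0 V6 []], Branch V0 V6 [Branch V2 V6 []], Branch
    V2 V6 [Branch V5 V6 [], Branch V0 V6 [Branch V1 V6 []]]], Branch V5 V6 [Branch V4 V6 [Branch V6 V7 [], Branch V0
    V6 [Branch V1 V6 []]]]], Branch V1 V6 [Branch V5 V6 [Branch V0 V6 [Branch V2 V6 []]]]], Branch V0 V6 [Branch V1 V6
    [Branch V2 V6 [Branch V3 V6 [Branch V4 V6 []]]]]], Branch V5 V8 [Branch V1 V8 [Branch V3 V8 [Branch V0 V8 [Branch
    V7 V8 [Branch V5 V6 []], Branch V1 V6 [Branch V3 V6 []], Branch V1 V6 [Branch V3 V6 []]], Branch V2 V6 [Branch V0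
    V6 [Branch V1 V6 []]]], Branch V0 V6 [Branch V5 V6 [Branch V1 V6 [Branch V2 V6 []]]]], Branch V0 V6 [Branch V1 V6
    [Branch V2 V6 [Branch V3 V6 [Branch V4 V6 []]]]]]], Branch V6 V8 [Branch V5 V6 [Branch V0 V6 [Branch V2 V6 [Branch
    V1 V6 [Branch V3 V6 [Branch V1 V7 [], Branch V5 V7 []], Branch V0 V7 [Branch V2 V7 []], Branch V2 V7 [Branch V5 V7
    [], Branch V0 V7 [Branch V1 V7 []]]], Branch V3 V7 [Branch V0 V7 [Branch V2 V7 []]]], Branch V1 V7 [Branch V5 V7
    [Branch V0 V7 [Branch V2 V7 []]]]], Branch V0 V7 [Branch V1 V7 [Branch V2 V7 [Branch V3 V7 [Branch V4 V7 []]]]]],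
    Branch V5 V7 [Branch V7 V8 [Branch V4 V7 [Branch V6 V7 [Branch V0 V7 [Branch V1 V7 []], Branch V0 V6 [Branch V1 V6
    [Branch V2 V6 []]]], Branch V0 V6 [Branch V1 V6 [Branch V2 V6 [Branch V3 V6 []]]]]]]], Branch V6 V8 [Branch V5 V6
    [Branch V1 V6 [Branch V3 V6 [Branch V0 V6 [Branch V2 V6 [Branch V1 V7 [], Branch V5 V7 []], Branch V1 V7 [Branch
    V3 V7 []], Branch V3 V7 [Branch V5 V7 [], Branch V1 V7 [Branch V2 V7 []]]], Branch V2 V7 [Branch V0 V7 [Branch V1
    V7 []]]], Branch V0 V7 [Branch V5 V7 [Branch V1 V7 [Branch V2 V7 []]]]], Branch V0 V7 [Branch V1 V7 [Branch V2 V7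
    [Branch V3 V7 [Branch V4 V7 []]]]]], Branch V5 V7 [Branch V7 V8 [Branch V4 V7 [Branch V6 V7 [Branch V0 V7 [Branch
    V1 V7 []], Branch V0 V6 [Branch V1 V6 [Branch V2 V6 []]]], Branch V0 V6 [Branch V1 V6 [Branch V2 V6 [Branch V3 V6
    []]]]]]]]])"
  by code_simp

lemma refutes_clique4: "refutes [] (
    clique_pattern [Low V0, Low V1, Low V2, Low V2, Low V1, Low V0, Low V3, Low V4, Low V5, Low V6, Low V4, Low V7, Low V8, High V0, Low V0])
  (
    Branch V4 V7 [Branch V4 V8 [Branch V2 V7 [Branch V1 V7 [Branch V0 V7 [Branch V3 V7 [], Branch V4 V6 [Branch V1 V8
    []], Branch V4 V6 [Branch V1 V8 []], Branch V4 V6 [Branch V1 V8 []], Branch V4 V6 [Branch V1 V8 []]], Branch V0 V7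
    [Branch V3 V7 []], Branch V0 V6 [Branch V4 V6 [Branch V0 V8 []], Branch V1 V6 [Branch V2 V6 []], Branch V2 V8
    [Branch V3 V8 []], Branch V0 V8 [Branch V2 V8 [], Branch V1 V6 [Branch V2 V6 []]]], Branch V2 V6 [Branch V4 V6
    [Branch V0 V8 []], Branch V0 V6 [Branch V1 V6 []], Branch V0 V8 [Branch V2 V8 []]], Branch V4 V6 [Branch V2 V6
    [Branch V0 V6 [], Branch V0 V8 []], Branch V0 V8 [Branch V2 V8 []]], Branch V0 V6 [Branch V4 V6 [Branch V0 V8 []],
    Branch V1 V6 [Branch V2 V6 []], Branch V0 V8 [Branch V2 V8 [], Branch V1 V6 [Branch V2 V6 []]], Branch V2 V8
    [Branch V3 V8 []]]], Branch V0 V7 [Branch V1 V7 [Branch V5 V7 []]], Branch V7 V8 [Branch V4 V6 [Branch V6 V7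
    [Branch V5 V6 [], Branch V0 V8 [], Branch V0 V6 []], Branch V5 V6 [Branch V5 V8 []], Branch V0 V8 [Branch V1 V8
    []]], Branch V4 V6 [Branch V0 V6 [Branch V5 V6 []]], Branch V0 V7 [Branch V1 V7 [Branch V3 V7 []]]], Branch V3 V8
    [Branch V0 V8 [Branch V7 V8 [Branch V3 V6 []], Branch V1 V6 [Branch V3 V6 []], Branch V1 V6 [Branch V3 V6 []]],
    Branch V0 V6 [Branch V1 V6 [Branch V2 V6 []]]], Branch V2 V6 [Branch V1 V6 [Branch V4 V6 [Branch V1 V8 []], Branch
    V0 V6 [Branch V3 V6 []], Branch V1 V8 [Branch V0 V8 [], Branch V0 V6 [Branch V3 V6 []]], Branch V0 V8 [Branch V3
    V8 []]], Branch V1 V6 [Branch V0 V6 [Branch V4 V6 []]], Branch V0 V7 [Branch V0 V6 [Branch V1 V6 []]], Branch V0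
    V8 [Branch V1 V8 [Branch V3 V8 []]]]], Branch V5 V7 [Branch V2 V7 [Branch V1 V7 [Branch V7 V8 [Branch V5 V6 []],
    Branch V0 V6 [Branch V2 V6 []], Branch V0 V6 [Branch V2 V6 []]], Branch V3 V6 [Branch V0 V6 [Branch V1 V6 []]]],
    Branch V0 V6 [Branch V1 V6 [Branch V2 V6 [Branch V3 V6 []]]]], Branch V5 V7 [Branch V3 V7 [Branch V1 V7 [Branch V7
    V8 [Branch V5 V6 []], Branch V0 V6 [Branch V2 V6 []], Branch V0 V6 [Branch V3 V6 []]], Branch V2 V6 [Branch V0 V6
    [Branch V1 V6 []]]], Branch V0 V6 [Branch V1 V6 [Branch V2 V6 [Branch V3 V6 []]]]]], Branch V5 V8 [Branch V2 V6
    [Branch V5 V6 [Branch V2 V8 [Branch V4 V6 [Branch V0 V6 [], Branch V6 V7 [], Branch V0 V8 []], Branch V0 V6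
    [Branch V1 V6 []], Branch V0 V6 [Branch V1 V6 []]], Branch V0 V8 [Branch V1 V8 [Branch V2 V8 []]]], Branch V0 V8
    [Branch V0 V6 [Branch V1 V6 [Branch V4 V6 []]]], Branch V3 V8 [Branch V0 V8 [Branch V1 V8 [Branch V2 V8 []]]]],
    Branch V0 V6 [Branch V1 V6 [Branch V4 V6 [Branch V2 V6 [Branch V3 V6 []]]]]], Branch V5 V8 [Branch V3 V6 [Branch
    V5 V6 [Branch V3 V8 [Branch V4 V6 [Branch V0 V6 [], Branch V6 V7 [], Branch V0 V8 []], Branch V0 V6 [Branch V1 V6
    []], Branch V0 V6 [Branch V1 V6 []]], Branch V0 V8 [Branch V1 V8 [Branch V2 V8 []]]], Branch V0 V8 [Branch V0 V6
    [Branch V1 V6 [Branch V4 V6 []]]], Branch V2 V8 [Branch V0 V8 [Branch V1 V8 [Branch V3 V8 []]]]], Branch V0 V6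
    [Branch V1 V6 [Branch V4 V6 [Branch V2 V6 [Branch V3 V6 []]]]]]])"
  by code_simp

lemma refutes_clique5: "refutes [] (
    clique_pattern [Low V0, Low V1, Low V2, Low V2, Low V1, Low V3, Low V4, Low V5, Low V6, Low V7, Low V6, Low V7, Low V8, High V0, Low V1])
  (
    Branch V0 V6 [Branch V1 V6 [Branch V4 V6 [Branch V2 V6 [Branch V3 V6 [Branch V1 V7 [Branch V0 V8 [], Branch V4 V8
    []], Branch V1 V7 [Branch V0 V8 []], Branch V1 V7 [Branch V4 V8 [], Branch V0 V8 []]], Branch V6 V7 [Branch V1 V7
    [Branch V0 V8 [], Branch V4 V8 []], Branch V1 V8 [Branch V3 V8 []], Branch V3 V6 [Branch V5 V6 []]], Branch V0 V8
    [Branch V0 V7 [Branch V1 V8 []], Branch V0 V7 [Branch V1 V7 []]], Branch V6 V8 [Branch V6 V7 [Branch V3 V8 [],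
    Branch V3 V6 []], Branch V3 V7 [Branch V5 V7 []], Branch V3 V6 [Branch V5 V6 []]]], Branch V0 V7 [Branch V1 V7
    [Branch V4 V7 [Branch V0 V8 [], Branch V2 V6 []], Branch V0 V8 [Branch V1 V8 []]], Branch V5 V8 [Branch V0 V8
    [Branch V1 V8 []]]], Branch V5 V8 [Branch V6 V7 [Branch V5 V7 [Branch V0 V8 []], Branch V2 V7 [Branch V3 V7 []],
    Branch V0 V8 [Branch V1 V8 []]], Branch V0 V7 [Branch V1 V7 [Branch V2 V7 []]]], Branch V0 V7 [Branch V1 V7
    [Branch V4 V7 [Branch V2 V6 [], Branch V0 V8 []], Branch V0 V8 [Branch V1 V8 []]], Branch V2 V8 [Branch V0 V8
    [Branch V1 V8 []]]]], Branch V4 V7 [Branch V0 V8 [Branch V4 V8 [Branch V0 V7 [Branch V1 V7 [], Branch V3 V8 []],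
    Branch V0 V7 [Branch V3 V7 []]], Branch V3 V7 [Branch V0 V7 [Branch V1 V7 []]], Branch V3 V7 [Branch V0 V7 [Branch
    V5 V7 []]]], Branch V3 V8 [Branch V0 V8 [Branch V2 V8 [Branch V4 V8 []]]]], Branch V3 V8 [Branch V5 V7 [Branch V6
    V7 [Branch V3 V7 [Branch V0 V8 []], Branch V2 V7 [Branch V3 V7 []], Branch V0 V8 [Branch V2 V8 []]], Branch V0 V8
    [Branch V0 V7 [Branch V1 V7 []]], Branch V4 V8 [Branch V0 V8 [Branch V1 V8 []]]], Branch V0 V7 [Branch V1 V7
    [Branch V2 V7 [Branch V3 V7 []]]]], Branch V0 V7 [Branch V4 V8 [Branch V0 V8 [Branch V4 V7 [Branch V1 V7 [],
    Branch V3 V8 []], Branch V2 V7 [Branch V3 V7 []]], Branch V3 V7 [Branch V1 V7 [Branch V4 V7 []]], Branch V5 V7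
    [Branch V3 V7 [Branch V4 V7 []]]], Branch V2 V8 [Branch V0 V8 [Branch V3 V8 [Branch V4 V8 []]]]]], Branch V1 V7
    [Branch V4 V7 [Branch V4 V8 [Branch V1 V8 [Branch V3 V6 [Branch V2 V6 [Branch V2 V7 []], Branch V2 V6 [Branch V2
    V8 []], Branch V0 V7 [Branch V2 V7 [], Branch V2 V7 [], Branch V0 V8 []]], Branch V0 V7 [Branch V2 V7 []], Branch
    V2 V7 [Branch V3 V7 []]], Branch V2 V7 [Branch V0 V7 [Branch V3 V7 []]], Branch V2 V7 [Branch V3 V7 [Branch V5 V7
    []]]], Branch V2 V8 [Branch V1 V8 [Branch V4 V8 [Branch V5 V8 []]]]], Branch V2 V8 [Branch V4 V8 [Branch V5 V8
    [Branch V1 V8 [Branch V3 V8 []]]]]], Branch V6 V7 [Branch V3 V7 [Branch V5 V7 [Branch V1 V7 [Branch V2 V7 [Branch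
    V0 V8 []], Branch V3 V8 [Branch V5 V8 []], Branch V0 V8 [Branch V2 V8 []]], Branch V2 V8 [Branch V0 V8 [Branch V1
    V8 []]]], Branch V1 V8 [Branch V2 V8 [Branch V0 V8 [Branch V3 V8 []]]]], Branch V2 V8 [Branch V6 V8 [Branch V1 V8
    [Branch V3 V8 [Branch V4 V8 []]]]]], Branch V1 V7 [Branch V4 V7 [Branch V2 V7 [Branch V3 V7 [Branch V0 V7 [Branch
    V1 V6 [], Branch V1 V8 []], Branch V1 V8 [Branch V2 V8 []], Branch V1 V8 [Branch V2 V8 []]], Branch V1 V8 [Branch
    V0 V8 [Branch V4 V8 [], Branch V1 V6 [Branch V2 V6 []]]], Branch V1 V8 [Branch V3 V8 [Branch V4 V8 []]]], Branch
    V5 V8 [Branch V4 V8 [Branch V1 V8 [Branch V2 V8 []]]]], Branch V3 V8 [Branch V1 V8 [Branch V2 V8 [Branch V4 V8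
    [Branch V5 V8 []]]]]]])"
  by code_simp

lemma refutes_clique6: "refutes [] (
    clique_pattern [Low V0, Low V1, Low V2, Low V2, Low V1, Low V3, Low V4, Low V5, Low V6, Low V7, Low V6, Low V8, High V0, Low V5, Low V1])
  (
    Branch V0 V6 [Branch V3 V6 [Branch V1 V6 [Branch V5 V6 [Branch V4 V6 [Branch V0 V7 [Branch V3 V8 [], Branch V5 V8
    []], Branch V0 V7 [Branch V0 V8 []], Branch V0 V7 [Branch V2 V8 [], Branch V5 V8 []]], Branch V0 V7 [Branch V0 V8
    [Branch V3 V7 []], Branch V0 V8 [Branch V3 V8 []]], Branch V4 V7 [Branch V6 V7 [Branch V4 V8 []], Branch V0 V8
    [Branch V1 V8 []]], Branch V0 V7 [Branch V0 V8 [Branch V2 V7 []], Branch V0 V8 [Branch V2 V8 []]]], Branch V4 V7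
    [Branch V3 V8 [Branch V4 V8 [Branch V0 V7 []], Branch V0 V7 [Branch V1 V7 []], Branch V0 V7 [Branch V2 V7 []],
    Branch V0 V7 [Branch V5 V7 []]], Branch V3 V8 [Branch V0 V8 [Branch V2 V8 []]]], Branch V3 V8 [Branch V3 V7
    [Branch V0 V7 [Branch V1 V7 [], Branch V0 V8 []], Branch V0 V8 [Branch V1 V8 []]], Branch V0 V7 [Branch V1 V7
    [Branch V2 V7 []]]], Branch V4 V7 [Branch V3 V8 [Branch V4 V8 [Branch V0 V7 []], Branch V0 V7 [Branch V3 V7 []],
    Branch V0 V7 [Branch V5 V7 []], Branch V0 V7 [Branch V2 V7 []]], Branch V5 V8 [Branch V0 V8 [Branch V3 V8 []]]]],
    Branch V5 V7 [Branch V0 V7 [Branch V5 V8 [Branch V0 V8 [Branch V1 V7 [], Branch V1 V7 []], Branch V1 V7 [Branch V3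
    V7 []], Branch V1 V7 [Branch V4 V7 []]], Branch V1 V8 [Branch V0 V8 [Branch V4 V8 []]]], Branch V4 V8 [Branch V5
    V8 [Branch V0 V8 [Branch V1 V8 []]]]], Branch V1 V8 [Branch V1 V7 [Branch V6 V8 [Branch V4 V8 [Branch V3 V7 [],
    Branch V0 V7 []], Branch V2 V8 [Branch V4 V8 []], Branch V2 V7 [Branch V6 V7 [], Branch V2 V6 [Branch V4 V6 []]]],
    Branch V0 V8 [Branch V2 V8 [Branch V3 V8 []]]], Branch V0 V7 [Branch V1 V7 [Branch V2 V7 [Branch V3 V7 []]]]],
    Branch V0 V7 [Branch V5 V7 [Branch V0 V8 [Branch V5 V8 [Branch V1 V7 [], Branch V1 V7 []], Branch V1 V7 [Branch V3
    V7 []], Branch V1 V7 [Branch V2 V7 []]], Branch V1 V8 [Branch V0 V8 [Branch V4 V8 []]]], Branch V2 V8 [Branch V0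
    V8 [Branch V1 V8 [Branch V4 V8 []]]]]], Branch V6 V7 [Branch V2 V7 [Branch V1 V7 [Branch V3 V7 [Branch V4 V7
    [Branch V1 V8 []], Branch V1 V8 [Branch V4 V8 []], Branch V4 V8 [Branch V2 V8 [], Branch V4 V7 [Branch V0 V8
    []]]], Branch V2 V8 [Branch V1 V8 [Branch V3 V8 []]]], Branch V0 V8 [Branch V1 V8 [Branch V2 V8 [Branch V3 V8
    []]]]], Branch V2 V8 [Branch V6 V8 [Branch V1 V8 [Branch V3 V8 [Branch V4 V8 []]]]]], Branch V3 V7 [Branch V5 V7
    [Branch V5 V8 [Branch V3 V8 [Branch V4 V6 [Branch V2 V6 [Branch V0 V7 []], Branch V2 V6 [Branch V0 V8 []], Branch
    V0 V7 [Branch V1 V7 [], Branch V1 V7 [], Branch V0 V8 []]], Branch V0 V7 [Branch V1 V7 []], Branch V1 V7 [Branch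
    V2 V7 []]], Branch V0 V7 [Branch V1 V7 [Branch V2 V7 []]], Branch V4 V7 [Branch V1 V7 [Branch V2 V7 []]]], Branch
    V4 V8 [Branch V5 V8 [Branch V2 V8 [Branch V3 V8 []]]]], Branch V2 V8 [Branch V4 V8 [Branch V5 V8 [Branch V1 V8
    [Branch V3 V8 []]]]]], Branch V3 V7 [Branch V5 V7 [Branch V3 V8 [Branch V5 V8 [Branch V1 V6 [Branch V2 V6 [Branch
    V0 V7 []], Branch V2 V6 [Branch V0 V8 []], Branch V0 V7 [Branch V1 V7 [], Branch V1 V7 [], Branch V0 V8 []]],
    Branch V0 V7 [Branch V1 V7 []], Branch V1 V7 [Branch V2 V7 []]], Branch V0 V7 [Branch V1 V7 [Branch V2 V7 []]],
    Branch V1 V7 [Branch V2 V7 [Branch V4 V7 []]]], Branch V2 V8 [Branch V1 V8 [Branch V3 V8 [Branch V4 V8 []]]]],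
    Branch V1 V8 [Branch V3 V8 [Branch V2 V8 [Branch V4 V8 [Branch V5 V8 []]]]]]])"
  by code_simp

lemma refutes_clique7: "refutes [] (
    clique_pattern [Low V0, Low V1, Low V2, Low V2, Low V1, Low V0, Low V3, Low V4, Low V5, Low V6, Low V7, Low V8, High V0, High V1, Low V0])
  (
    Branch V4 V7 [Branch V2 V7 [Branch V0 V7 [Branch V1 V7 [Branch V4 V6 [Branch V3 V8 []], Branch V4 V6 [Branch V2 V8
    []], Branch V6 V7 [Branch V5 V8 [], Branch V0 V6 [], Branch V0 V6 []], Branch V4 V6 [Branch V0 V6 [], Branch V2 V8
    []]], Branch V4 V6 [Branch V4 V8 [Branch V2 V6 []], Branch V2 V8 [Branch V3 V8 []]], Branch V4 V6 [Branch V4 V8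
    [Branch V2 V6 []], Branch V2 V8 [Branch V4 V8 []]], Branch V4 V6 [Branch V4 V8 [Branch V2 V6 []], Branch V2 V8
    [Branch V4 V8 []]], Branch V4 V6 [Branch V4 V8 [Branch V2 V6 []], Branch V2 V8 [Branch V4 V8 []]]], Branch V4 V6
    [Branch V4 V8 [Branch V2 V6 [Branch V0 V6 [], Branch V0 V8 [], Branch V0 V8 [], Branch V0 V6 []], Branch V0 V6
    [Branch V1 V6 []]], Branch V1 V8 [Branch V0 V8 [Branch V4 V8 []]]], Branch V4 V6 [Branch V4 V8 [Branch V2 V6
    [Branch V0 V6 [], Branch V0 V8 [], Branch V0 V6 [], Branch V0 V8 []], Branch V0 V6 [Branch V1 V6 []]], Branch V0
    V8 [Branch V1 V8 [Branch V4 V8 []]]], Branch V4 V6 [Branch V4 V8 [Branch V2 V6 [Branch V0 V6 [], Branch V0 V8 [],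
    Branch V0 V6 [], Branch V0 V8 []], Branch V0 V6 [Branch V1 V6 []]], Branch V4 V8 [Branch V0 V8 [Branch V1 V8
    []]]], Branch V4 V6 [Branch V4 V8 [Branch V2 V6 [Branch V0 V6 [], Branch V0 V6 [], Branch V0 V8 [], Branch V0 V8
    []], Branch V0 V6 [Branch V1 V6 []]], Branch V4 V8 [Branch V0 V8 [Branch V1 V8 []]]]], Branch V5 V8 [Branch V5 V6
    [Branch V0 V8 [Branch V0 V6 [Branch V2 V6 [], Branch V2 V8 [], Branch V2 V8 []], Branch V1 V6 [Branch V2 V6 []],
    Branch V2 V6 [Branch V3 V6 []], Branch V2 V6 [Branch V3 V6 []]], Branch V4 V8 [Branch V0 V8 [Branch V1 V8 []],
    Branch V0 V6 [Branch V1 V6 [Branch V2 V6 []]]], Branch V0 V7 [Branch V0 V6 [Branch V1 V6 []]]], Branch V4 V6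
    [Branch V6 V8 [Branch V0 V6 [Branch V1 V6 []], Branch V0 V6 [Branch V1 V6 [Branch V2 V6 []]]], Branch V0 V6
    [Branch V1 V6 [Branch V2 V6 [Branch V3 V6 []]]]], Branch V0 V7 [Branch V1 V7 [Branch V2 V7 [Branch V3 V7 []]]]],
    Branch V5 V8 [Branch V5 V6 [Branch V0 V8 [Branch V0 V6 [Branch V2 V6 [], Branch V2 V8 [], Branch V2 V8 []], Branch
    V1 V6 [Branch V2 V6 []], Branch V2 V6 [Branch V3 V6 []], Branch V2 V6 [Branch V3 V6 []]], Branch V0 V7 [Branch V0
    V6 [Branch V1 V6 []]], Branch V4 V8 [Branch V0 V8 [Branch V1 V8 []], Branch V0 V6 [Branch V1 V6 [Branch V2 V6
    []]]]], Branch V0 V7 [Branch V1 V7 [Branch V2 V7 [Branch V3 V7 []]]], Branch V4 V6 [Branch V6 V8 [Branch V0 V6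
    [Branch V1 V6 []], Branch V0 V6 [Branch V1 V6 [Branch V2 V6 []]]], Branch V0 V6 [Branch V1 V6 [Branch V2 V6
    [Branch V3 V6 []]]]]]])"
  by code_simp

lemma refutes_clique8: "refutes [] (
    clique_pattern [Low V0, Low V1, Low V2, Low V2, Low V1, Low V3, Low V4, Low V5, Low V6, Low V7, Low V6, Low V8, High V0, High V1, Low V1])
  (
    Branch V3 V8 [Branch V4 V8 [Branch V1 V8 [Branch V0 V8 [Branch V4 V6 [Branch V2 V7 []], Branch V2 V6 [Branch V1 V7
    [], Branch V4 V7 []], Branch V2 V6 [Branch V4 V7 [], Branch V1 V7 []], Branch V4 V6 [Branch V2 V7 []]], Branch V4
    V6 [Branch V4 V7 [Branch V2 V6 []], Branch V2 V7 [Branch V3 V7 []]], Branch V3 V6 [Branch V3 V7 [Branch V0 V6 []],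
    Branch V0 V7 [Branch V1 V7 []]], Branch V6 V8 [Branch V4 V6 [Branch V0 V6 [], Branch V5 V7 []], Branch V3 V7
    [Branch V5 V7 [], Branch V0 V6 [Branch V2 V6 []]], Branch V0 V6 [Branch V1 V6 []]]], Branch V5 V7 [Branch V2 V7
    [Branch V0 V7 [Branch V2 V6 [], Branch V2 V6 []], Branch V0 V6 [Branch V3 V6 []], Branch V0 V6 [Branch V3 V6 []]],
    Branch V2 V6 [Branch V0 V6 [Branch V1 V6 []]], Branch V0 V6 [Branch V2 V6 [Branch V3 V6 []]]], Branch V5 V6
    [Branch V3 V6 [Branch V6 V8 [Branch V5 V7 []], Branch V0 V7 [Branch V1 V7 []]], Branch V0 V7 [Branch V1 V7 [Branch
    V2 V7 []]]], Branch V7 V8 [Branch V6 V8 [Branch V3 V6 [Branch V1 V6 [], Branch V0 V7 [], Branch V5 V7 []], Branch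
    V0 V6 [Branch V1 V6 []], Branch V1 V7 [Branch V2 V7 []]], Branch V0 V8 [Branch V0 V7 [Branch V1 V7 []]], Branch V3
    V6 [Branch V1 V6 [Branch V2 V6 []]]]], Branch V3 V6 [Branch V4 V6 [Branch V0 V6 [Branch V5 V6 [Branch V0 V7 []],
    Branch V1 V7 [Branch V2 V7 []], Branch V2 V7 [Branch V4 V7 []]], Branch V1 V7 [Branch V0 V7 [Branch V2 V7 []]],
    Branch V0 V7 [Branch V2 V7 [Branch V5 V7 []]]], Branch V1 V7 [Branch V2 V7 [Branch V0 V7 [Branch V4 V7 []]]],
    Branch V0 V6 [Branch V2 V6 [Branch V1 V6 [Branch V4 V6 []]]]], Branch V7 V8 [Branch V4 V7 [Branch V0 V7 [Branch V1
    V7 [Branch V0 V6 []], Branch V2 V6 [Branch V4 V6 []], Branch V1 V6 [Branch V3 V6 []]], Branch V1 V6 [Branch V0 V6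
    [Branch V2 V6 []]]], Branch V1 V6 [Branch V6 V8 [Branch V0 V6 [Branch V2 V6 []]]]], Branch V5 V7 [Branch V1 V7
    [Branch V0 V7 [Branch V2 V7 [Branch V0 V6 [], Branch V0 V6 []], Branch V1 V6 [Branch V2 V6 []], Branch V1 V6
    [Branch V2 V6 []]], Branch V0 V6 [Branch V2 V6 [Branch V5 V6 []]], Branch V0 V6 [Branch V2 V6 [Branch V4 V6 []]]],
    Branch V1 V6 [Branch V0 V6 [Branch V2 V6 [Branch V4 V6 []]]]]])"
  by code_simp

lemma refutes_clique9: "refutes [] (
    clique_pattern [Low V0, Low V1, Low V2, Low V2, Low V1, Low V3, Low V4, Low V5, Low V6, Low V7, Low V8, High V0, High V1, High V2, Low V1])
  (
    Branch V0 V6 [Branch V3 V6 [Branch V1 V6 [Branch V4 V7 [Branch V2 V8 []], Branch V0 V7 [Branch V4 V8 [], Branch V4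
    V8 []], Branch V5 V7 [Branch V2 V8 []], Branch V0 V7 [Branch V5 V8 [], Branch V5 V8 []]], Branch V5 V8 [Branch V5
    V7 [Branch V0 V8 []], Branch V0 V7 [Branch V5 V7 []]], Branch V4 V7 [Branch V4 V8 [Branch V0 V7 []], Branch V0 V8
    [Branch V4 V8 []]], Branch V4 V8 [Branch V4 V7 [Branch V0 V8 []], Branch V0 V7 [Branch V4 V7 []]], Branch V5 V7
    [Branch V5 V8 [Branch V0 V7 []], Branch V0 V8 [Branch V5 V8 []]]], Branch V4 V7 [Branch V1 V8 [Branch V4 V8
    [Branch V1 V7 []], Branch V0 V7 [Branch V1 V7 []], Branch V2 V7 [Branch V5 V7 [], Branch V1 V6 [Branch V3 V6 []]],
    Branch V2 V7 [Branch V5 V7 [], Branch V1 V6 [Branch V3 V6 []]]], Branch V3 V8 [Branch V1 V8 [Branch V4 V8 []]]],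
    Branch V2 V7 [Branch V5 V8 [Branch V5 V7 [Branch V1 V8 []], Branch V1 V7 [Branch V3 V7 []], Branch V1 V7 [Branch
    V3 V7 []]], Branch V1 V8 [Branch V3 V8 [Branch V4 V8 []]], Branch V1 V8 [Branch V3 V8 [Branch V4 V8 []]], Branch
    V5 V6 [Branch V1 V6 [Branch V3 V6 []]]], Branch V5 V7 [Branch V1 V8 [Branch V5 V8 [Branch V1 V7 []], Branch V0 V7
    [Branch V1 V7 []], Branch V2 V7 [Branch V4 V7 [], Branch V1 V6 [Branch V3 V6 []]], Branch V2 V7 [Branch V4 V7 [],
    Branch V1 V6 [Branch V3 V6 []]]], Branch V3 V8 [Branch V1 V8 [Branch V5 V8 []]]], Branch V2 V7 [Branch V4 V8
    [Branch V4 V7 [Branch V1 V8 []], Branch V1 V7 [Branch V3 V7 []], Branch V1 V7 [Branch V3 V7 []]], Branch V1 V8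
    [Branch V3 V8 [Branch V4 V8 []]], Branch V4 V6 [Branch V1 V6 [Branch V3 V6 []]], Branch V1 V8 [Branch V3 V8
    [Branch V4 V8 []]]]])"
  by code_simp

text \<open>No opposite pair agrees: all colors but the triple one are distinct. The 13 names leave
  a single fresh color, and the tree is correspondingly small.\<close>

lemma refutes_clique10: "refutes [] (
    clique_pattern [Low V0, Low V1, Low V2, Low V2, Low V3, Low V4, Low V5, Low V6, Low V7, Low V8, High V0, High V1, High V2, High V3, Low V2])
  (
    Branch V1 V6 [Branch V0 V6 [Branch V1 V7 [Branch V4 V8 [], Branch V4 V8 []], Branch V1 V7 [Branch V4 V8 [], Branch
    V4 V8 []], Branch V1 V7 [Branch V4 V8 [], Branch V4 V8 []], Branch V1 V7 [Branch V4 V8 [], Branch V4 V8 []]],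
    Branch V0 V8 [Branch V0 V7 [Branch V4 V8 [], Branch V4 V8 []], Branch V4 V7 [Branch V5 V7 []], Branch V4 V7
    [Branch V5 V7 []]], Branch V3 V8 [Branch V3 V7 [Branch V4 V8 [], Branch V4 V8 []], Branch V4 V7 [Branch V5 V7 []],
    Branch V4 V7 [Branch V5 V7 []]], Branch V0 V8 [Branch V0 V7 [Branch V4 V8 [], Branch V4 V8 []], Branch V4 V7
    [Branch V5 V7 []], Branch V4 V7 [Branch V5 V7 []]], Branch V3 V8 [Branch V3 V7 [Branch V4 V8 [], Branch V4 V8 []],
    Branch V4 V7 [Branch V5 V7 []], Branch V4 V7 [Branch V5 V7 []]]])"
  by code_simp

section \<open>From three edges of one color to a K6\<close>

definition triple :: pattern where
  "triple = [(V0, V1, Low V0), (V2, V3, Low V0), (V4, V5, Low V0)]"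

text \<open>The tree colors the twelve other edges of the K6. It has two subtrees exactly where the
  second edge of an opposite pair is reached, one for disagreement and one for agreement, and so
  ends in 64 copies. The embeddings permute the six vertices of the clique and fix
  \<open>V6\<close>, \<open>V7\<close>, \<open>V8\<close>.\<close>

lemma refutes_triple: "refutes clique_patterns triple (
    Branch V0 V2 [Branch V1 V2 [Branch V0 V3 [Branch V1 V3 [Branch V0 V4 [Branch V1 V4 [Branch V2 V4 [Branch V3 V4
    [Branch V0 V5 [Branch V1 V5 [Branch V2 V5 [Branch V3 V5 [Copy 10 (Row V0 V2 V3 V1 V4 V5 V6 V7 V8), Copy 9 (Row V2
    V5 V3 V4 V0 V1 V6 V7 V8)], Branch V3 V5 [Copy 9 (Row V2 V4 V3 V5 V0 V1 V6 V7 V8), Copy 7 (Row V2 V3 V4 V5 V0 V1 V6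
    V7 V8)]], Branch V2 V5 [Branch V3 V5 [Copy 9 (Row V0 V5 V1 V4 V2 V3 V6 V7 V8), Copy 8 (Row V4 V1 V5 V0 V3 V2 V6 V7
    V8)], Branch V3 V5 [Copy 8 (Row V4 V1 V5 V0 V2 V3 V6 V7 V8), Copy 4 (Row V4 V5 V2 V3 V1 V0 V6 V7 V8)]]], Branch V1
    V5 [Branch V2 V5 [Branch V3 V5 [Copy 9 (Row V0 V4 V1 V5 V2 V3 V6 V7 V8), Copy 8 (Row V4 V0 V5 V1 V3 V2 V6 V7 V8)],
    Branch V3 V5 [Copy 8 (Row V4 V0 V5 V1 V2 V3 V6 V7 V8), Copy 4 (Row V4 V5 V2 V3 V0 V1 V6 V7 V8)]], Branch V2 V5
    [Branch V3 V5 [Copy 7 (Row V0 V1 V4 V5 V2 V3 V6 V7 V8), Copy 4 (Row V4 V5 V0 V1 V3 V2 V6 V7 V8)], Branch V3 V5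
    [Copy 4 (Row V4 V5 V0 V1 V2 V3 V6 V7 V8), Copy 2 (Row V4 V5 V0 V1 V2 V3 V6 V7 V8)]]]]]]]], Branch V0 V4 [Branch V1
    V4 [Branch V2 V4 [Branch V3 V4 [Branch V0 V5 [Branch V1 V5 [Branch V2 V5 [Branch V3 V5 [Copy 9 (Row V0 V3 V1 V2 V4
    V5 V6 V7 V8), Copy 8 (Row V2 V1 V3 V0 V5 V4 V6 V7 V8)], Branch V3 V5 [Copy 8 (Row V2 V1 V3 V0 V4 V5 V6 V7 V8),
    Copy 4 (Row V2 V3 V4 V5 V1 V0 V6 V7 V8)]], Branch V2 V5 [Branch V3 V5 [Copy 8 (Row V0 V3 V1 V2 V5 V4 V6 V7 V8),
    Copy 6 (Row V0 V3 V1 V2 V5 V4 V6 V7 V8)], Branch V3 V5 [Copy 5 (Row V0 V3 V1 V2 V5 V4 V6 V7 V8), Copy 3 (Row V2 V3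
    V4 V5 V1 V0 V6 V7 V8)]]], Branch V1 V5 [Branch V2 V5 [Branch V3 V5 [Copy 8 (Row V0 V3 V1 V2 V4 V5 V6 V7 V8), Copy
    5 (Row V0 V3 V1 V2 V4 V5 V6 V7 V8)], Branch V3 V5 [Copy 6 (Row V0 V3 V1 V2 V4 V5 V6 V7 V8), Copy 3 (Row V2 V3 V5
    V4 V1 V0 V6 V7 V8)]], Branch V2 V5 [Branch V3 V5 [Copy 4 (Row V0 V1 V4 V5 V3 V2 V6 V7 V8), Copy 3 (Row V0 V1 V4 V5
    V3 V2 V6 V7 V8)], Branch V3 V5 [Copy 3 (Row V0 V1 V5 V4 V3 V2 V6 V7 V8), Copy 1 (Row V4 V5 V0 V1 V3 V2 V6 V7
    V8)]]]]]]]]], Branch V1 V3 [Branch V0 V4 [Branch V1 V4 [Branch V2 V4 [Branch V3 V4 [Branch V0 V5 [Branch V1 V5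
    [Branch V2 V5 [Branch V3 V5 [Copy 9 (Row V0 V2 V1 V3 V4 V5 V6 V7 V8), Copy 8 (Row V2 V0 V3 V1 V5 V4 V6 V7 V8)],
    Branch V3 V5 [Copy 8 (Row V2 V0 V3 V1 V4 V5 V6 V7 V8), Copy 4 (Row V2 V3 V4 V5 V0 V1 V6 V7 V8)]], Branch V2 V5
    [Branch V3 V5 [Copy 8 (Row V0 V2 V1 V3 V5 V4 V6 V7 V8), Copy 5 (Row V0 V2 V1 V3 V5 V4 V6 V7 V8)], Branch V3 V5
    [Copy 6 (Row V0 V2 V1 V3 V5 V4 V6 V7 V8), Copy 3 (Row V2 V3 V5 V4 V0 V1 V6 V7 V8)]]], Branch V1 V5 [Branch V2 V5
    [Branch V3 V5 [Copy 8 (Row V0 V2 V1 V3 V4 V5 V6 V7 V8), Copy 6 (Row V0 V2 V1 V3 V4 V5 V6 V7 V8)], Branch V3 V5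
    [Copy 5 (Row V0 V2 V1 V3 V4 V5 V6 V7 V8), Copy 3 (Row V2 V3 V4 V5 V0 V1 V6 V7 V8)]], Branch V2 V5 [Branch V3 V5
    [Copy 4 (Row V0 V1 V4 V5 V2 V3 V6 V7 V8), Copy 3 (Row V0 V1 V5 V4 V2 V3 V6 V7 V8)], Branch V3 V5 [Copy 3 (Row V0
    V1 V4 V5 V2 V3 V6 V7 V8), Copy 1 (Row V4 V5 V0 V1 V2 V3 V6 V7 V8)]]]]]]]], Branch V0 V4 [Branch V1 V4 [Branch V2
    V4 [Branch V3 V4 [Branch V0 V5 [Branch V1 V5 [Branch V2 V5 [Branch V3 V5 [Copy 7 (Row V0 V1 V2 V3 V4 V5 V6 V7 V8),
    Copy 4 (Row V2 V3 V0 V1 V5 V4 V6 V7 V8)], Branch V3 V5 [Copy 4 (Row V2 V3 V0 V1 V4 V5 V6 V7 V8), Copy 2 (Row V2 V3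
    V0 V1 V4 V5 V6 V7 V8)]], Branch V2 V5 [Branch V3 V5 [Copy 4 (Row V0 V1 V2 V3 V5 V4 V6 V7 V8), Copy 3 (Row V0 V1 V2
    V3 V5 V4 V6 V7 V8)], Branch V3 V5 [Copy 3 (Row V0 V1 V3 V2 V5 V4 V6 V7 V8), Copy 1 (Row V2 V3 V0 V1 V5 V4 V6 V7
    V8)]]], Branch V1 V5 [Branch V2 V5 [Branch V3 V5 [Copy 4 (Row V0 V1 V2 V3 V4 V5 V6 V7 V8), Copy 3 (Row V0 V1 V3 V2
    V4 V5 V6 V7 V8)], Branch V3 V5 [Copy 3 (Row V0 V1 V2 V3 V4 V5 V6 V7 V8), Copy 1 (Row V2 V3 V0 V1 V4 V5 V6 V7
    V8)]], Branch V2 V5 [Branch V3 V5 [Copy 2 (Row V0 V1 V2 V3 V4 V5 V6 V7 V8), Copy 1 (Row V0 V1 V2 V3 V5 V4 V6 V7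
    V8)], Branch V3 V5 [Copy 1 (Row V0 V1 V2 V3 V4 V5 V6 V7 V8), Copy 0 (Row V0 V1 V2 V3 V4 V5 V6 V7 V8)]]]]]]]]]]]])"
  by code_simp

lemma not_matches_clique:
  assumes "pat \<in> set clique_patterns" "small_parity_coloring F"
  shows "\<not> matches F pat"
proof -
  have "\<exists>c. refutes [] pat c"
    using assms(1) unfolding clique_patterns_def
    by (auto intro: refutes_clique0 refutes_clique1 refutes_clique2 refutes_clique3 refutes_clique4 refutes_clique5 refutes_clique6 refutes_clique7 refutes_clique8 refutes_clique9 refutes_clique10)
  then show ?thesis
    \<comment> \<open>The trees for the K6 colorings stand on their own: the list of previously
      refuted patterns is empty.\<close>
    using refutes_sound[OF _ assms(2), of "[]"] by auto
qed

text \<open>\<open>triple\<close> contains one name only, so matching it means precisely that the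
  three edges share a color.\<close>

lemma no_triple:
  assumes "small_parity_coloring F"
  shows "\<not> (F V0 V1 = F V2 V3 \<and> F V2 V3 = F V4 V5)"
  using refutes_sound[OF refutes_triple assms not_matches_clique] by (auto simp: matches_def triple_def)

section \<open>Colorings of complete graphs\<close>

definition xor_coloring :: "('a \<Rightarrow> nat) \<Rightarrow> 'a set \<Rightarrow> nat" where
  "xor_coloring h e = xor (Min (h ` e)) (Max (h ` e))"

text \<open>A coloring is a function of the edge as a set. Minimum and maximum of the labels recover
  both ends without choosing an order, and \<open>xor\<close> is symmetric.\<close>

lemma xor_coloring: "xor_coloring h {u, v} = xor (h u) (h v)"
  by (cases "h u \<le> h v") (auto simp: xor_coloring_def min_def max_def ac_simps)

text \<open>By commutativity the first letter can be moved next to its copy, where the two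
  cancel.\<close>

lemma foldr_xor_even_word: "even_word xs \<Longrightarrow> foldr xor xs 0 = (0 :: nat)"
proof (induction xs rule: even_word.induct)
  case (2 x xs)
  have "foldr xor xs 0 = xor x (foldr xor (remove1 x xs) 0)" if "x \<in> set xs"
    using that by (induction xs) (auto simp: xor.left_commute)
  then show ?case using 2 by (simp flip: xor.assoc)
qed simp

text \<open>Being below 16 means being fixed by truncation to four bits, and truncation commutes
  with \<open>xor\<close>.\<close>

lemma xor_less_16: "xor a b < (16 :: nat)" if "a < 16" "b < 16"
proof -
  have "take_bit 4 a = a" "take_bit 4 b = b"
    using that by (simp_all add: take_bit_nat_eq_self)
  then have "take_bit 4 (xor a b) = xor a b" by (simp add: take_bit_xor)
  then show ?thesis using take_bit_nat_less_exp[of 4 "xor a b"] by simp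
qed

lemma even_word_count_list: "even_word xs \<longleftrightarrow> (\<forall>x. even (count_list xs x))"
  by (simp add: even_word_iff count_mset)

lemma xor_eq_0_iff: "xor a b = 0 \<longleftrightarrow> a = (b :: nat)"
  by (simp add: bit_eq_iff bit_xor_iff)

context graph begin

text \<open>The sum telescopes: the label of each inner visit to a vertex enters through two
  consecutive edges and cancels.\<close>

lemma foldr_xor_awalk:
  "awalk u p v \<Longrightarrow> foldr xor (map (\<lambda>e. xor_coloring h (edge_of G e)) p) 0 = xor (h u) (h v)"
proof (induction p arbitrary: u)
  case (Cons e p)
  have "xor x (xor x y) = y" for x y :: nat
    by (simp flip: xor.assoc)
  with Cons show ?case
    by (auto simp: awalk_Cons_iff edge_of_def xor_coloring xor.assoc)
qed (auto simp: awalk_Nil_iff)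

text \<open>A parity walk has color sum 0, so its ends have equal labels; injectivity of the
  labelling then makes the walk closed, which a path with an edge is not.\<close>

lemma parity_edge_coloring_xor:
  assumes "inj_on h (verts G)"
  shows "parity_edge_coloring G (xor_coloring h)"
  unfolding parity_edge_coloring_def
proof (intro notI, elim exE)
  fix u p v assume "parity_path G (xor_coloring h) u p v"
  then have p: "awalk u p v" "even_word (map (\<lambda>e. xor_coloring h (edge_of G e)) p)"
    and "apath u p v" "p \<noteq> []"
    by (auto simp: parity_path_def parity_walk_def even_word_count_list)
  then have "xor (h u) (h v) = 0"
    using foldr_xor_awalk foldr_xor_even_word by metis
  then have "h u = h v"
    by (simp add: xor_eq_0_iff)
  moreover have "u \<in> verts G" "v \<in> verts G"
    using p(1) awalk_hd_in_verts awalk_last_in_verts by blast+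
  moreover have "u \<noteq> v"
    using \<open>apath u p v\<close> \<open>p \<noteq> []\<close> apath_nonempty_ends by blast
  ultimately show False using assms by (auto simp: inj_on_def)
qed

end

section \<open>Paths of K9 as lists of vertices\<close>

context
  fixes G :: "('a, 'b) pre_digraph"
  assumes K9: "K\<^bsub>9\<^esub> G"
begin

interpretation graph G
  using K9 by (simp add: complete_digraph_def)

lemma card_verts: "card (verts G) = 9"
  using K9 by (simp add: complete_digraph_def)

lemma edges_K9: "edges G = {e. e \<subseteq> verts G \<and> card e = 2}"
proof -
  have ends: "arcs_ends G = {(u, v). (u, v) \<in> verts G \<times> verts G \<and> u \<noteq> v}"
    using K9 by (simp add: complete_digraph_def)
  have "edges G = (\<lambda>(u, v). {u, v}) ` arcs_ends G"
    by (auto simp: edges_def edge_of_def arcs_ends_def arc_to_ends_def)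
  also have "\<dots> = {e. e \<subseteq> verts G \<and> card e = 2}"
    unfolding ends by (fastforce simp: card_2_iff)
  finally show ?thesis .
qed

lemma arcE:
  assumes "u \<in> verts G" "v \<in> verts G" "u \<noteq> v"
  obtains e where "e \<in> arcs G" "tail G e = u" "head G e = v"
proof -
  have "(u, v) \<in> arcs_ends G"
    using K9 assms by (simp add: complete_digraph_def)
  then show ?thesis
    using that by (auto simp: arcs_ends_def arc_to_ends_def)
qed

text \<open>Completeness supplies an arc between any two consecutive vertices; this links the vertex
  lists of the checker with walks as lists of arcs.\<close>

lemma awalk_of_path:
  assumes "set (u # vs) \<subseteq> verts G" "distinct (u # vs)"
  shows "\<exists>p. awalk u p (last (u # vs)) \<and> awalk_verts u p = u # vs \<and>
    map (\<lambda>e. f (edge_of G e)) p = path_word (\<lambda>u v. f {u, v}) (u # vs)"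
  using assms
proof (induction vs arbitrary: u)
  case Nil
  then show ?case by (intro exI[of _ "[]"]) (auto simp: awalk_Nil_iff)
next
  case (Cons v vs)
  then obtain p where p: "awalk v p (last (v # vs))" "awalk_verts v p = v # vs"
    "map (\<lambda>e. f (edge_of G e)) p = path_word (\<lambda>u v. f {u, v}) (v # vs)"
    using Cons.IH[of v] by auto
  obtain e where "e \<in> arcs G" "tail G e = u" "head G e = v"
    using Cons.prems arcE[of u v] by auto
  with p show ?case
    by (intro exI[of _ "e # p"]) (auto simp: awalk_Cons_iff edge_of_def)
qed

lemma parity_edge_coloring_path:
  assumes "parity_edge_coloring G f" "set vs \<subseteq> verts G" "distinct vs" "2 \<le> length vs"
  shows "\<not> even_word (path_word (\<lambda>u v. f {u, v}) vs)"
proof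
  assume ev: "even_word (path_word (\<lambda>u v. f {u, v}) vs)"
  obtain u v ws where vs: "vs = u # v # ws"
    using assms(4) by (metis Suc_le_length_iff numeral_2_eq_2)
  obtain p where p: "awalk u p (last vs)" "awalk_verts u p = vs"
    "map (\<lambda>e. f (edge_of G e)) p = path_word (\<lambda>u v. f {u, v}) vs"
    using awalk_of_path[of u "v # ws"] assms(2,3) unfolding vs by blast
  then have "parity_path G f u p (last vs)"
    using ev assms(3) vs unfolding parity_path_def parity_walk_def apath_def even_word_count_list
    by auto
  then show False
    using assms(1) by (auto simp: parity_edge_coloring_def)
qed

text \<open>Neighbors in a list of distinct vertices differ, so only values off the diagonal are
  read. This lets the coloring passed to the checker be filled in freely on the diagonal.\<close>

lemma path_word_cong:
  assumes "\<And>u v. u \<noteq> v \<Longrightarrow> f u v = g u v" "distinct vs"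
  shows "path_word f vs = path_word g vs"
  using assms(2)
proof (induction vs rule: induct_list012)
  case (3 u v vs)
  then show ?case using assms(1)[of u v] by simp
qed simp_all

section \<open>The lower bound\<close>

lemma parity_edge_coloring_lower:
  assumes f: "parity_edge_coloring G f"
  shows "15 \<le> card (f ` edges G)"
proof (rule ccontr)
  assume "\<not> 15 \<le> card (f ` edges G)"
  then have le14: "card (f ` edges G) \<le> 14" by simp
  have fin: "finite (edges G)"
    by (simp add: edges_def)
  have "card (edges G) = 36"
    unfolding edges_K9 by (simp add: n_subsets card_verts choose_two)
  moreover have "card (edges G) \<le> (\<Sum>c\<in>f ` edges G. card {e \<in> edges G. f e = c})"
  proof -
    have "edges G = (\<Union>c\<in>f ` edges G. {e \<in> edges G. f e = c})" by auto
    then show ?thesis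
      using card_UN_le[of "f ` edges G" "\<lambda>c. {e \<in> edges G. f e = c}"] fin by auto
  qed
  ultimately have sum: "36 \<le> (\<Sum>c\<in>f ` edges G. card {e \<in> edges G. f e = c})"
    by simp
  \<comment> \<open>Fourteen color classes of at most two edges would cover only 28 of the 36
    edges.\<close>
  have "\<exists>c. 3 \<le> card {e \<in> edges G. f e = c}"
  proof (rule ccontr)
    assume "\<not> ?thesis"
    then have "card {e \<in> edges G. f e = c} \<le> 2" for c
      by (metis not_less_eq_eq numeral_2_eq_2 numeral_3_eq_3)
    then have "(\<Sum>c\<in>f ` edges G. card {e \<in> edges G. f e = c}) \<le> (\<Sum>c\<in>f ` edges G. 2)"
      by (intro sum_mono)
    then show False using sum le14 by simp
  qed
  then obtain c where "3 \<le> card {e \<in> edges G. f e = c}" ..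
  then obtain T where T: "T \<subseteq> {e \<in> edges G. f e = c}" "card T = 3"
    by (rule obtain_subset_with_card_n)
  from T(2) obtain e1 e2 e3 where "T = {e1, e2, e3}" "e1 \<noteq> e2" "e1 \<noteq> e3" "e2 \<noteq> e3"
    by (auto simp: card_3_iff)
  with T(1) have e: "e1 \<in> edges G" "e2 \<in> edges G" "e3 \<in> edges G"
    "f e1 = c" "f e2 = c" "f e3 = c" "e1 \<noteq> e2" "e1 \<noteq> e3" "e2 \<noteq> e3"
    by blast+
  have disj: "d \<inter> e = {}" if de: "d \<in> edges G" "e \<in> edges G" "f d = f e" "d \<noteq> e" for d e
  proof (rule ccontr)
    assume "d \<inter> e \<noteq> {}"
    then obtain x where x: "x \<in> d" "x \<in> e" by blast
    obtain y where y: "d = {x, y}" "x \<noteq> y"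
      using de(1) x(1) by (auto simp: edges_K9 card_2_iff)
    obtain z where z: "e = {x, z}" "x \<noteq> z"
      using de(2) x(2) by (auto simp: edges_K9 card_2_iff)
    have "y \<noteq> z" "{x, y, z} \<subseteq> verts G"
      using de y z by (auto simp: edges_K9)
    \<comment> \<open>Two edges of one color with a common end \<open>x\<close> form the parity path
      \<open>y x z\<close>.\<close>
    then show False
      using parity_edge_coloring_path[OF f, of "[y, x, z]"] de(3) y z
      by (simp add: insert_commute)
  qed
  obtain a1 b1 a2 b2 a3 b3 where ab: "e1 = {a1, b1}" "e2 = {a2, b2}" "e3 = {a3, b3}"
      "a1 \<noteq> b1" "a2 \<noteq> b2" "a3 \<noteq> b3"
    using e(1-3) unfolding edges_K9 card_2_iff by blast
  have six: "distinct [a1, b1, a2, b2, a3, b3]" "set [a1, b1, a2, b2, a3, b3] \<subseteq> verts G"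
    using disj[of e1 e2] disj[of e1 e3] disj[of e2 e3] e ab unfolding edges_K9 by auto
  have "card (verts G - set [a1, b1, a2, b2, a3, b3]) = 3"
    using six card_verts by (subst card_Diff_subset) (auto simp: distinct_card[OF six(1)] simp del: set_simps)
  then obtain r1 r2 r3 where r: "verts G - set [a1, b1, a2, b2, a3, b3] = {r1, r2, r3}"
      "r1 \<noteq> r2" "r1 \<noteq> r3" "r2 \<noteq> r3"
    by (auto simp: card_3_iff)
  \<comment> \<open>The three edges become \<open>V0 V1\<close>, \<open>V2 V3\<close>,
    \<open>V4 V5\<close>, the position required by \<open>no_triple\<close>; the remaining vertices
    fill \<open>V6\<close>, \<open>V7\<close>, \<open>V8\<close>.\<close>
  define p where "p = get (Row a1 b1 a2 b2 a3 b3 r1 r2 r3)"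
  have "{r1, r2, r3} \<inter> set [a1, b1, a2, b2, a3, b3] = {}" "{r1, r2, r3} \<subseteq> verts G"
    using r(1) by blast+
  then have nine: "distinct (map p vertices)" "set (map p vertices) \<subseteq> verts G"
    using six r(2-4) unfolding p_def vertices_def by simp_all
  then have inj: "inj p" and verts: "p v \<in> verts G" for v
    by (auto simp: distinct_map set_vertices)
  \<comment> \<open>On the diagonal any color of an edge will do; \<open>c\<close> is one, so the
    range stays within the colors of \<open>f\<close>.\<close>
  define F where "F u v = (if u = v then c else f {p u, p v})" for u v
  have "F u v \<in> f ` edges G" for u v
  proof (cases "u = v")
    case False
    then have "{p u, p v} \<in> edges G"
      using inj verts by (auto simp: edges_K9 inj_eq)
    then show ?thesis using False by (simp add: F_def)
  qed (use e(1,4) in \<open>auto simp: F_def\<close>)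
  then have "range (case_prod F) \<subseteq> f ` edges G" by auto
  then have "card (range (case_prod F)) \<le> 14"
    using le14 fin by (meson card_mono finite_imageI le_trans)
  moreover have "\<not> even_word (path_word F vs)" if "distinct vs" "2 \<le> length vs" for vs
  proof -
    have "path_word F vs = path_word (\<lambda>u v. f {u, v}) (map p vs)"
      unfolding path_word_map by (rule path_word_cong) (simp_all add: F_def that)
    moreover have "distinct (map p vs)"
      using that inj by (auto simp: distinct_map intro: inj_on_subset)
    ultimately show ?thesis
      using parity_edge_coloring_path[OF f, of "map p vs"] that verts by auto
  qed
  ultimately have "small_parity_coloring F"
    by (auto simp: small_parity_coloring_def F_def insert_commute)
  then show False
    using no_triple[of F] e ab by (simp add: F_def p_def)
qed

text \<open>At most 15 colors is enough here: together with the lower bound it forces exactly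
  15.\<close>

lemma parity_edge_coloring_upper:
  "\<exists>f :: 'a set \<Rightarrow> nat. parity_edge_coloring G f \<and> card (f ` edges G) \<le> 15"
proof -
  obtain h where h: "bij_betw h (verts G) {0..<9::nat}"
    using ex_bij_betw_finite_nat[OF finite_verts] by (auto simp: card_verts)
  have "xor_coloring h ` edges G \<subseteq> {1..15}"
  proof
    fix c assume "c \<in> xor_coloring h ` edges G"
    then obtain u v where uv: "u \<in> verts G" "v \<in> verts G" "u \<noteq> v" "c = xor (h u) (h v)"
      by (auto simp: edges_K9 card_2_iff xor_coloring)
    then have "h u \<in> {0..<9}" "h v \<in> {0..<9}" "h u \<noteq> h v"
      using h by (auto simp: bij_betw_def inj_on_def)
    then show "c \<in> {1..15}"
      using xor_less_16[of "h u" "h v"] xor_eq_0_iff[of "h u" "h v"] uv(4) by (auto simp: Suc_le_eq)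
  qed
  then have "card (xor_coloring h ` edges G) \<le> 15"
    by (metis card_mono finite_atLeastAtMost card_atLeastAtMost diff_Suc_1 One_nat_def)
  moreover have "parity_edge_coloring G (xor_coloring h)"
    using h by (intro parity_edge_coloring_xor) (simp add: bij_betw_def)
  ultimately show ?thesis by blast
qed

end

theorem theorem5p2:
  fixes G :: "('a, 'b) pre_digraph"
  assumes "K\<^bsub>9\<^esub> G"
  shows "parity_number G = 15"
proof -
  define P where "P k \<longleftrightarrow> (\<exists>f :: 'a set \<Rightarrow> nat. parity_edge_coloring G f \<and> card (f ` edges G) = k)" for k
  have low: "15 \<le> k" if "P k" for k
    using that parity_edge_coloring_lower[OF assms] by (auto simp: P_def)
  obtain k where "P k" "k \<le> 15"
    using parity_edge_coloring_upper[OF assms] by (auto simp: P_def)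
  \<comment> \<open>The number of colors just obtained is squeezed between the two bounds, so 15 is
    attained.\<close>
  then have "P 15" using low by (metis le_antisym)
  then have "(LEAST k. P k) = 15"
    using low by (intro Least_equality) auto
  then show ?thesis by (simp add: parity_number_def P_def)
qed

end
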